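(* Let $\sigma:(\mathbb{R}^2,0)\to(\mathbb{R}^2,0)$ be a $C^1$ diffeomorphism germ and let $f,g:(\mathbb{R}^2,0)\to(\mathbb{R},0)$ be real analytic function germs, not identically zero, such that $f=g\circ\sigma$. Suppose that $\gamma\subset f^{-1}(0)$ and $\tilde\gamma\subset g^{-1}(0)$ are real Newton-Puiseux roots of $f$ and $g$ respectively such that $\sigma(\gamma)=\tilde\gamma$ as set germs at $0$. Then the Puiseux characteristic pairs of $\gamma$ and $\tilde\gamma$ coincide.
   Context: A real Newton-Puiseux root of $f(x,y)=0$ is a demi-branch of a real analytic arc $\gamma\subset f^{-1}(0)$, considered as a set germ at $0$, parametrised by $\gamma: x=\lambda(y)=a_1y^{n_1/N}+a_2y^{n_2/N}+\cdots$, $y\ge 0$, where $\lambda$ is a convergent fractional power series with real coefficients, $N$ and $n_1<n_2<\cdots$ are positive integers, and $n_1/N\ge 1$ (so $\gamma$ is transverse to the $x$-axis). Puiseux pairs: write $\lambda(y)=\sum_\alpha a_\alpha y^\alpha$. The Puiseux (characteristic) pairs of $\gamma$ are the pairs of relatively prime positive integers $(n_1,d_1),\ldots,(n_q,d_q)$ with $d_i>1$ and $\frac{n_1}{d_1}<\frac{n_2}{d_1d_2}<\cdots<\frac{n_q}{d_1\cdots d_q}$, such that $a_{n_i/(d_1\cdots d_i)}\neq 0$ for $i=1,\ldots,q$, all exponents $\alpha$ with $a_\alpha\ne0$ and $\alpha<n_1/d_1$ are integers, all exponents $\alpha$ with $a_\alpha\neq 0$ and $\alpha<\frac{n_{i+1}}{d_1\cdots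 d_{i+1}}$ lie in $\frac{1}{d_1\cdots d_i}\mathbb{Z}$ ($1\le i<q$), and all exponents $\alpha$ with $a_\alpha\ne0$ lie in $\frac1{d_1\cdots d_q}\mathbb{Z}$. *)

theory Defs
  imports "HOL-Analysis.Analysis"
begin

subsection \<open>Germs at the origin\<close>

definition analytic_germ :: "(real \<times> real \<Rightarrow> real) \<Rightarrow> bool" where
  "analytic_germ f \<longleftrightarrow>
     (\<exists>c :: nat \<times> nat \<Rightarrow> real. \<exists>r > 0. \<forall>x y. \<bar>x\<bar> < r \<longrightarrow> \<bar>y\<bar> < r \<longrightarrow>
        ((\<lambda>(i, j). c (i, j) * x ^ i * y ^ j) has_sum f (x, y)) UNIV)"

definition set_germ_eq :: "(real \<times> real) set \<Rightarrow> (real \<times> real) set \<Rightarrow> bool" where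
  "set_germ_eq A B \<longleftrightarrow> (\<forall>\<^sub>F p in nhds 0. p \<in> A \<longleftrightarrow> p \<in> B)"

definition set_germ_subset :: "(real \<times> real) set \<Rightarrow> (real \<times> real) set \<Rightarrow> bool" where
  "set_germ_subset A B \<longleftrightarrow> (\<forall>\<^sub>F p in nhds 0. p \<in> A \<longrightarrow> p \<in> B)"

definition C1_on :: "'a set \<Rightarrow> ('a::real_normed_vector \<Rightarrow> 'b::real_normed_vector) \<Rightarrow> bool" where
  "C1_on U h \<longleftrightarrow>
     (\<exists>h' :: 'a \<Rightarrow> 'a \<Rightarrow>\<^sub>L 'b. (\<forall>p\<in>U. (h has_derivative blinfun_apply (h' p)) (at p)) \<and>
        continuous_on U h')"

definition C1_diffeomorphism ::
  "'a set \<Rightarrow> 'b set \<Rightarrow> ('a::real_normed_vector \<Rightarrow> 'b::real_normed_vector) \<Rightarrow> bool" where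
  "C1_diffeomorphism U V h \<longleftrightarrow>
     open U \<and> open V \<and> bij_betw h U V \<and> C1_on U h \<and> C1_on V (inv_into U h)"

text \<open>
  A germ \<open>(\<real>\<^sup>2,0) \<rightarrow> (\<real>\<^sup>2,0)\<close> is given by a representative \<open>\<sigma> : U \<rightarrow> V\<close>.  The neighbourhood
  \<open>U\<close> is kept explicit because the total function \<open>\<sigma>\<close> is unconstrained outside \<open>U\<close>: the image germ
  of a set germ \<open>\<gamma>\<close> is that of \<open>\<sigma> ` (\<gamma> \<inter> U)\<close>, not that of \<open>\<sigma> ` \<gamma>\<close>.
\<close>

definition C1_diffeo_germ ::
  "(real \<times> real) set \<Rightarrow> (real \<times> real) set \<Rightarrow> (real \<times> real \<Rightarrow> real \<times> real) \<Rightarrow> bool" where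
  "C1_diffeo_germ U V \<sigma> \<longleftrightarrow> 0 \<in> U \<and> \<sigma> 0 = 0 \<and> C1_diffeomorphism U V \<sigma>"

subsection \<open>Real Newton-Puiseux roots\<close>

text \<open>
  A fractional power series \<open>\<lambda>(y) = \<Sum>\<^sub>\<alpha> a\<^sub>\<alpha> y\<^sup>\<alpha>\<close> is represented by its coefficient function
  \<open>a\<close>, indexed by the rational exponents.  Since all exponents are at least \<open>1\<close>, the convention
  \<open>0 powr \<alpha> = 0\<close> gives the right value at \<open>y = 0\<close>.  The zero series is allowed; it parametrises
  the positive \<open>y\<close>-axis.
\<close>

definition puiseux_value :: "(rat \<Rightarrow> real) \<Rightarrow> real \<Rightarrow> real" where
  "puiseux_value a y = (\<Sum>\<^sub>\<infinity>\<alpha>. a \<alpha> * y powr real_of_rat \<alpha>)"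

definition puiseux_series :: "(rat \<Rightarrow> real) \<Rightarrow> bool" where
  "puiseux_series a \<longleftrightarrow>
     (\<exists>N::nat. N > 0 \<and> (\<forall>\<alpha>. a \<alpha> \<noteq> 0 \<longrightarrow> 1 \<le> \<alpha> \<and> of_nat N * \<alpha> \<in> \<int>)) \<and>
     (\<exists>\<delta> > 0. \<forall>y\<in>{0..<\<delta>}. (\<lambda>\<alpha>. a \<alpha> * y powr real_of_rat \<alpha>) summable_on UNIV)"

definition newton_puiseux_root ::
  "(real \<times> real \<Rightarrow> real) \<Rightarrow> (rat \<Rightarrow> real) \<Rightarrow> (real \<times> real) set \<Rightarrow> bool" where
  "newton_puiseux_root f a \<gamma> \<longleftrightarrow>
     puiseux_series a \<and>
     set_germ_eq \<gamma> {(puiseux_value a y, y) | y. 0 \<le> y} \<and>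
     set_germ_subset \<gamma> (f -` {0})"

subsection \<open>Puiseux characteristic pairs\<close>

text \<open>
  In a list \<open>[(n\<^sub>1, d\<^sub>1), \<dots>, (n\<^sub>q, d\<^sub>q)]\<close>, indexed from \<open>0\<close>, the value \<open>pair_denom ps i\<close> is
  \<open>d\<^sub>1 \<cdots> d\<^sub>i\<close> (so \<open>1\<close> for \<open>i = 0\<close>) and \<open>pair_exponent ps i\<close> is
  \<open>n\<^bsub>i+1\<^esub> / (d\<^sub>1 \<cdots> d\<^bsub>i+1\<^esub>)\<close>.
\<close>

definition pair_denom :: "(nat \<times> nat) list \<Rightarrow> nat \<Rightarrow> nat" where
  "pair_denom ps i = (\<Prod>j<i. snd (ps ! j))"

definition pair_exponent :: "(nat \<times> nat) list \<Rightarrow> nat \<Rightarrow> rat" where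
  "pair_exponent ps i = of_nat (fst (ps ! i)) / of_nat (pair_denom ps (Suc i))"

definition is_puiseux_pairs :: "(rat \<Rightarrow> real) \<Rightarrow> (nat \<times> nat) list \<Rightarrow> bool" where
  "is_puiseux_pairs a ps \<longleftrightarrow>
     (\<forall>(n, d)\<in>set ps. 0 < n \<and> 1 < d \<and> coprime n d) \<and>
     (\<forall>i. Suc i < length ps \<longrightarrow> pair_exponent ps i < pair_exponent ps (Suc i)) \<and>
     (\<forall>i<length ps. a (pair_exponent ps i) \<noteq> 0) \<and>
     (\<forall>i<length ps. \<forall>\<alpha>. a \<alpha> \<noteq> 0 \<longrightarrow> \<alpha> < pair_exponent ps i \<longrightarrow>
        of_nat (pair_denom ps i) * \<alpha> \<in> \<int>) \<and>
     (\<forall>\<alpha>. a \<alpha> \<noteq> 0 \<longrightarrow> of_nat (pair_denom ps (length ps)) * \<alpha> \<in> \<int>)"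

definition puiseux_pairs :: "(rat \<Rightarrow> real) \<Rightarrow> (nat \<times> nat) list" where
  "puiseux_pairs a = (THE ps. is_puiseux_pairs a ps)"

subsubsection \<open>The characteristic pairs are well defined\<close>

lemma coprime_frac_not_Int:
  fixes n d :: nat
  assumes "coprime n d" "1 < d"
  shows "(of_nat n / of_nat d :: rat) \<notin> \<int>"
proof
  assume "(of_nat n / of_nat d :: rat) \<in> \<int>"
  then obtain k :: int where "(of_nat n / of_nat d :: rat) = of_int k" by (auto elim: Ints_cases)
  with assms have "(of_int (int n) :: rat) = of_int (k * int d)" by (simp add: field_simps)
  then have "int n = k * int d" by (simp only: of_int_eq_iff)
  then have "int d dvd int n" by simp
  then have "d dvd n" by simp
  with assms have "d dvd 1" by (metis coprime_common_divisor dvd_refl)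
  with assms show False by simp
qed

lemma coprime_frac_eq:
  fixes n d n' d' :: nat
  assumes "coprime n d" "coprime n' d'" "0 < d" "0 < d'"
    and "(of_nat n / of_nat d :: rat) = of_nat n' / of_nat d'"
  shows "n = n' \<and> d = d'"
proof -
  from assms have "(of_nat (n * d') :: rat) = of_nat (n' * d)" by (simp add: field_simps)
  then have eq: "n * d' = n' * d" by (simp only: of_nat_eq_iff)
  then have "d dvd n * d'" "d' dvd n' * d" by (metis dvd_triv_right)+
  with assms have "d dvd d'" "d' dvd d"
    by (metis coprime_commute coprime_dvd_mult_right_iff)+
  then have "d = d'" by (rule dvd_antisym)
  with eq assms show ?thesis by simp
qed

lemma pair_denom_Suc: "pair_denom ps (Suc i) = pair_denom ps i * snd (ps ! i)"
  by (simp add: pair_denom_def)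

lemma pair_denom_cong:
  assumes "take i ps = take i qs"
  shows "pair_denom ps i = pair_denom qs i"
  unfolding pair_denom_def using assms
  by (intro prod.cong refl) (metis lessThan_iff nth_take)

lemma pairs_nth:
  assumes "\<forall>(n, d)\<in>set ps. 0 < n \<and> 1 < d \<and> coprime n d" "i < length ps"
  shows "1 < snd (ps ! i)" "coprime (fst (ps ! i)) (snd (ps ! i))"
  using bspec[OF assms(1) nth_mem[OF assms(2)]] by (simp_all add: case_prod_beta)

lemma pair_denom_pos:
  assumes "\<forall>(n, d)\<in>set ps. 0 < n \<and> 1 < d \<and> coprime n d" "i \<le> length ps"
  shows "0 < pair_denom ps i"
proof -
  have "0 < snd (ps ! j)" if "j < i" for j
    using pairs_nth(1)[OF assms(1), of j] that assms(2) by simp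
  then show ?thesis unfolding pair_denom_def by (intro prod_pos) auto
qed

lemma denom_mult_exponent:
  assumes "\<forall>(n, d)\<in>set ps. 0 < n \<and> 1 < d \<and> coprime n d" "i < length ps"
  shows "of_nat (pair_denom ps i) * pair_exponent ps i
           = of_nat (fst (ps ! i)) / of_nat (snd (ps ! i))"
proof -
  have "pair_denom ps i \<noteq> 0" using pair_denom_pos[OF assms(1), of i] assms(2) by simp
  then show ?thesis by (simp add: pair_exponent_def pair_denom_Suc)
qed

lemmas is_puiseux_pairs_good = is_puiseux_pairs_def[THEN iffD1, THEN conjunct1]
lemmas is_puiseux_pairs_increasing = is_puiseux_pairs_def[THEN iffD1, THEN conjunct2, THEN conjunct1, rule_format]
lemmas is_puiseux_pairs_nonzero = is_puiseux_pairs_def[THEN iffD1, THEN conjunct2, THEN conjunct2, THEN conjunct1, rule_format]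
lemmas is_puiseux_pairs_denom = is_puiseux_pairs_def[THEN iffD1, THEN conjunct2, THEN conjunct2, THEN conjunct2, THEN conjunct1, rule_format]
lemmas is_puiseux_pairs_all_denom = is_puiseux_pairs_def[THEN iffD1, THEN conjunct2, THEN conjunct2, THEN conjunct2, THEN conjunct2, rule_format]

lemma is_puiseux_pairs_step:
  assumes ps: "is_puiseux_pairs a ps" and qs: "is_puiseux_pairs a qs"
    and tk: "take i ps = take i qs" and i: "i < length ps" "i \<le> length qs"
  shows "i < length qs \<and> ps ! i = qs ! i"
proof -
  have gp: "\<forall>(n, d)\<in>set ps. 0 < n \<and> 1 < d \<and> coprime n d"
    and gq: "\<forall>(n, d)\<in>set qs. 0 < n \<and> 1 < d \<and> coprime n d"
    by (fact is_puiseux_pairs_good[OF ps] is_puiseux_pairs_good[OF qs])+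
  have denp: "of_nat (pair_denom ps i) * \<alpha> \<in> \<int>"
    if "a \<alpha> \<noteq> 0" "\<alpha> < pair_exponent ps i" for \<alpha>
    by (rule is_puiseux_pairs_denom[OF ps i(1) that])
  have denq: "of_nat (pair_denom qs i) * \<alpha> \<in> \<int>"
    if "i < length qs" "a \<alpha> \<noteq> 0" "\<alpha> < pair_exponent qs i" for \<alpha>
    by (rule is_puiseux_pairs_denom[OF qs that])
  have allq: "of_nat (pair_denom qs (length qs)) * \<alpha> \<in> \<int>" if "a \<alpha> \<noteq> 0" for \<alpha>
    by (rule is_puiseux_pairs_all_denom[OF qs that])
  have D: "pair_denom ps i = pair_denom qs i" using tk by (rule pair_denom_cong)
  have pi: "1 < snd (ps ! i)" "coprime (fst (ps ! i)) (snd (ps ! i))"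
    by (fact pairs_nth[OF gp i(1)])+
  have nip: "of_nat (pair_denom ps i) * pair_exponent ps i \<notin> \<int>"
    unfolding denom_mult_exponent[OF gp i(1)] using pi by (intro coprime_frac_not_Int)
  have ap: "a (pair_exponent ps i) \<noteq> 0" by (rule is_puiseux_pairs_nonzero[OF ps i(1)])
  have iq: "i < length qs"
  proof (rule ccontr)
    assume "\<not> i < length qs"
    then have "i = length qs" using i by simp
    then show False using allq[OF ap] nip D by simp
  qed
  have qi: "1 < snd (qs ! i)" "coprime (fst (qs ! i)) (snd (qs ! i))"
    by (fact pairs_nth[OF gq iq])+
  have niq: "of_nat (pair_denom qs i) * pair_exponent qs i \<notin> \<int>"
    unfolding denom_mult_exponent[OF gq iq] using qi by (intro coprime_frac_not_Int)
  have aq: "a (pair_exponent qs i) \<noteq> 0" by (rule is_puiseux_pairs_nonzero[OF qs iq])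
  have "\<not> pair_exponent ps i < pair_exponent qs i"
    using denq[OF iq ap] nip D by auto
  moreover have "\<not> pair_exponent qs i < pair_exponent ps i"
    using denp[OF aq] niq D by auto
  ultimately have "pair_exponent ps i = pair_exponent qs i" by simp
  then have "(of_nat (fst (ps ! i)) / of_nat (snd (ps ! i)) :: rat)
               = of_nat (fst (qs ! i)) / of_nat (snd (qs ! i))"
    using denom_mult_exponent[OF gp i(1)] denom_mult_exponent[OF gq iq] D by simp
  then have "fst (ps ! i) = fst (qs ! i) \<and> snd (ps ! i) = snd (qs ! i)"
    using pi qi by (intro coprime_frac_eq) auto
  then show ?thesis using iq by (simp add: prod_eq_iff)
qed

lemma is_puiseux_pairs_take:
  assumes "is_puiseux_pairs a ps" "is_puiseux_pairs a qs" "i \<le> length ps"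
  shows "i \<le> length qs \<and> take i ps = take i qs"
  using assms(3)
proof (induction i)
  case (Suc i)
  then show ?case
    using is_puiseux_pairs_step[OF assms(1,2), of i] by (simp add: take_Suc_conv_app_nth)
qed simp

lemma is_puiseux_pairs_unique:
  assumes "is_puiseux_pairs a ps" "is_puiseux_pairs a qs"
  shows "ps = qs"
  using is_puiseux_pairs_take[OF assms, of "length ps"]
    is_puiseux_pairs_take[OF assms(2,1), of "length qs"] by simp

text \<open>All conditions of \<open>is_puiseux_pairs\<close> except the last; a maximal such list is the list sought.\<close>

definition partial_pairs :: "(rat \<Rightarrow> real) \<Rightarrow> (nat \<times> nat) list \<Rightarrow> bool" where
  "partial_pairs a ps \<longleftrightarrow>
     (\<forall>(n, d)\<in>set ps. 0 < n \<and> 1 < d \<and> coprime n d) \<and>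
     (\<forall>i. Suc i < length ps \<longrightarrow> pair_exponent ps i < pair_exponent ps (Suc i)) \<and>
     (\<forall>i<length ps. a (pair_exponent ps i) \<noteq> 0) \<and>
     (\<forall>i<length ps. \<forall>\<alpha>. a \<alpha> \<noteq> 0 \<longrightarrow> \<alpha> < pair_exponent ps i \<longrightarrow>
        of_nat (pair_denom ps i) * \<alpha> \<in> \<int>)"

lemmas partial_pairs_good = partial_pairs_def[THEN iffD1, THEN conjunct1]
lemmas partial_pairs_increasing = partial_pairs_def[THEN iffD1, THEN conjunct2, THEN conjunct1, rule_format]
lemmas partial_pairs_nonzero = partial_pairs_def[THEN iffD1, THEN conjunct2, THEN conjunct2, THEN conjunct1, rule_format]
lemmas partial_pairs_denom = partial_pairs_def[THEN iffD1, THEN conjunct2, THEN conjunct2, THEN conjunct2, rule_format]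

lemma frac_exponents_least:
  fixes S :: "rat set" and N :: nat
  assumes "0 < N" "S \<noteq> {}" "\<forall>\<alpha>\<in>S. 1 \<le> \<alpha> \<and> of_nat N * \<alpha> \<in> \<int>"
  obtains \<alpha> where "\<alpha> \<in> S" "\<And>\<beta>. \<beta> \<in> S \<Longrightarrow> \<alpha> \<le> \<beta>"
proof -
  define m where "m = (\<lambda>\<alpha>::rat. nat \<lfloor>of_nat N * \<alpha>\<rfloor>)"
  have m: "of_nat (m \<alpha>) = of_nat N * \<alpha>" if "\<alpha> \<in> S" for \<alpha>
  proof -
    have "0 \<le> of_nat N * \<alpha>" using that assms(3) by fastforce
    moreover have "of_int \<lfloor>of_nat N * \<alpha>\<rfloor> = of_nat N * \<alpha>" using that assms(3) by simp
    ultimately show ?thesis unfolding m_def by (metis of_nat_nat zero_le_floor)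
  qed
  obtain \<alpha> where \<alpha>: "\<alpha> \<in> S" "\<And>\<beta>. \<beta> \<in> S \<Longrightarrow> m \<alpha> \<le> m \<beta>"
    using assms(2) ex_has_least_nat[of "\<lambda>x. x \<in> S" _ m] by blast
  have "\<alpha> \<le> \<beta>" if "\<beta> \<in> S" for \<beta>
  proof -
    have "(of_nat (m \<alpha>) :: rat) \<le> of_nat (m \<beta>)" using \<alpha>(2)[OF that] by simp
    then show ?thesis using m[OF \<alpha>(1)] m[OF that] assms(1) by simp
  qed
  with \<alpha>(1) show thesis by (rule that)
qed

lemma rat_coprime_quotient:
  fixes x :: rat
  assumes "0 < x" "x \<notin> \<int>"
  obtains n d :: nat where "x = of_nat n / of_nat d" "0 < n" "1 < d" "coprime n d"
proof -
  obtain p q where pq: "quotient_of x = (p, q)" by (cases "quotient_of x")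
  have x: "x = of_int p / of_int q" and q: "0 < q" and c: "coprime p q"
    using quotient_of_div[OF pq] quotient_of_denom_pos[OF pq] quotient_of_coprime[OF pq] by auto
  have p: "0 < p" using assms(1) x q by (simp add: zero_less_divide_iff)
  have "q \<noteq> 1" using assms(2) x by auto
  then have "1 < nat q" using q by simp
  moreover have "x = of_nat (nat p) / of_nat (nat q)" using x p q by simp
  moreover have "coprime (nat p) (nat q)" using c p q by (simp add: coprime_int_iff [symmetric])
  moreover have "0 < nat p" using p by simp
  ultimately show thesis by (intro that)
qed

lemma Ints_denom_mono:
  fixes \<alpha> :: rat
  assumes "of_nat (pair_denom ps i) * \<alpha> \<in> \<int>"
  shows "of_nat (pair_denom ps (Suc i)) * \<alpha> \<in> \<int>"
proof -
  have "of_nat (pair_denom ps (Suc i)) * \<alpha>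
          = of_nat (snd (ps ! i)) * (of_nat (pair_denom ps i) * \<alpha>)"
    by (simp add: pair_denom_Suc mult_ac)
  then show ?thesis using assms by (metis Ints_mult Ints_of_nat)
qed

lemma partial_pairs_extend:
  assumes P: "partial_pairs a ps" and "0 < N"
    and N: "\<forall>\<alpha>. a \<alpha> \<noteq> 0 \<longrightarrow> 1 \<le> \<alpha> \<and> of_nat N * \<alpha> \<in> \<int>"
    and ex: "\<exists>\<alpha>. a \<alpha> \<noteq> 0 \<and> of_nat (pair_denom ps (length ps)) * \<alpha> \<notin> \<int>"
  shows "\<exists>p. partial_pairs a (ps @ [p])"
proof -
  let ?D = "pair_denom ps (length ps)"
  let ?S = "{\<alpha>. a \<alpha> \<noteq> 0 \<and> of_nat ?D * \<alpha> \<notin> \<int>}"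
  have g: "\<forall>(n, d)\<in>set ps. 0 < n \<and> 1 < d \<and> coprime n d"
    and inc: "\<And>i. Suc i < length ps \<Longrightarrow> pair_exponent ps i < pair_exponent ps (Suc i)"
    and nz: "\<And>i. i < length ps \<Longrightarrow> a (pair_exponent ps i) \<noteq> 0"
    and den: "\<And>i \<alpha>. i < length ps \<Longrightarrow> a \<alpha> \<noteq> 0 \<Longrightarrow> \<alpha> < pair_exponent ps i \<Longrightarrow>
        of_nat (pair_denom ps i) * \<alpha> \<in> \<int>"
    by (fact partial_pairs_good[OF P] partial_pairs_increasing[OF P] partial_pairs_nonzero[OF P]
        partial_pairs_denom[OF P])+
  obtain \<alpha> where \<alpha>: "\<alpha> \<in> ?S" and least: "\<And>\<beta>. \<beta> \<in> ?S \<Longrightarrow> \<alpha> \<le> \<beta>"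
    using frac_exponents_least[OF \<open>0 < N\<close>, of ?S] N ex by blast
  have Dpos: "0 < ?D" using pair_denom_pos[OF g] by simp
  have "1 \<le> \<alpha>" using \<alpha> N by blast
  then have "0 < of_nat ?D * \<alpha>" using Dpos by simp
  then obtain n d where nd: "of_nat ?D * \<alpha> = of_nat n / of_nat d" "0 < n" "1 < d" "coprime n d"
    using rat_coprime_quotient[of "of_nat ?D * \<alpha>"] \<alpha> by blast
  let ?qs = "ps @ [(n, d)]"
  have dq: "pair_denom ?qs i = pair_denom ps i" if "i \<le> length ps" for i
    by (rule pair_denom_cong) (use that in simp)
  have eq: "pair_exponent ?qs i = pair_exponent ps i" if "i < length ps" for i
    using that dq[of "Suc i"] by (simp add: pair_exponent_def nth_append)
  have el: "pair_exponent ?qs (length ps) = \<alpha>"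
  proof -
    have "pair_exponent ?qs (length ps) = of_nat n / (of_nat ?D * of_nat d)"
      by (simp add: pair_exponent_def pair_denom_Suc dq)
    also have "\<dots> = (of_nat n / of_nat d) / of_nat ?D" by simp
    also have "\<dots> = \<alpha>" using nd(1)[symmetric] Dpos by simp
    finally show ?thesis .
  qed
  have last: "pair_exponent ps i < \<alpha>" if i: "Suc i = length ps" for i
  proof (rule ccontr)
    assume "\<not> pair_exponent ps i < \<alpha>"
    then consider "\<alpha> < pair_exponent ps i" | "\<alpha> = pair_exponent ps i" by fastforce
    then have "of_nat (pair_denom ps (Suc i)) * \<alpha> \<in> \<int>"
    proof cases
      case 1
      then have "of_nat (pair_denom ps i) * \<alpha> \<in> \<int>" using den[of i \<alpha>] \<alpha> i by simp
      then show ?thesis by (rule Ints_denom_mono)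
    next
      case 2
      have "pair_denom ps (Suc i) \<noteq> 0" using Dpos i by simp
      then have "of_nat (pair_denom ps (Suc i)) * \<alpha> = of_nat (fst (ps ! i))"
        using 2 unfolding pair_exponent_def by simp
      then show ?thesis by simp
    qed
    then show False using \<alpha> i by simp
  qed
  have "partial_pairs a ?qs"
    unfolding partial_pairs_def
  proof (intro conjI allI impI)
    show "\<forall>(n, d)\<in>set ?qs. 0 < n \<and> 1 < d \<and> coprime n d" using g nd by auto
  next
    fix i assume "Suc i < length ?qs"
    then consider "Suc i < length ps" | "Suc i = length ps" by fastforce
    then show "pair_exponent ?qs i < pair_exponent ?qs (Suc i)"
    proof cases
      case 1 then show ?thesis using eq inc by simp
    next
      case 2 then show ?thesis using eq[of i] el last[OF 2] by simp
    qed
  next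
    fix i assume "i < length ?qs"
    then consider "i < length ps" | "i = length ps" by fastforce
    then show "a (pair_exponent ?qs i) \<noteq> 0"
      by cases (use eq nz el \<alpha> in auto)
  next
    fix i \<beta> assume i: "i < length ?qs" and b: "a \<beta> \<noteq> 0" "\<beta> < pair_exponent ?qs i"
    from i consider "i < length ps" | "i = length ps" by fastforce
    then show "of_nat (pair_denom ?qs i) * \<beta> \<in> \<int>"
    proof cases
      case 1 then show ?thesis using b eq dq den by simp
    next
      case 2
      then have "\<beta> \<notin> ?S" using b el least[of \<beta>] by auto
      then show ?thesis using 2 b dq by simp
    qed
  qed
  then show ?thesis by blast
qed

lemma partial_pairs_denom_dvd:
  assumes P: "partial_pairs a ps"
    and N: "\<forall>\<alpha>. a \<alpha> \<noteq> 0 \<longrightarrow> 1 \<le> \<alpha> \<and> of_nat N * \<alpha> \<in> \<int>"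
  shows "i \<le> length ps \<Longrightarrow> pair_denom ps i dvd N \<and> 2 ^ i \<le> pair_denom ps i"
proof (induction i)
  case 0
  then show ?case by (simp add: pair_denom_def)
next
  case (Suc i)
  have g: "\<forall>(n, d)\<in>set ps. 0 < n \<and> 1 < d \<and> coprime n d" by (fact partial_pairs_good[OF P])
  let ?D = "pair_denom ps i" and ?n = "fst (ps ! i)" and ?d = "snd (ps ! i)"
  have i: "i < length ps" using Suc.prems by simp
  have nd: "1 < ?d" "coprime ?n ?d" by (fact pairs_nth[OF g i])+
  obtain M where M: "N = ?D * M" using Suc.IH i by (auto elim: dvdE)
  have "of_nat N * pair_exponent ps i \<in> \<int>" using N partial_pairs_nonzero[OF P i] by blast
  also have "of_nat N * pair_exponent ps i = of_nat M * (of_nat ?D * pair_exponent ps i)"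
    by (simp add: M)
  also have "\<dots> = of_nat (M * ?n) / of_nat ?d" using denom_mult_exponent[OF g i] by simp
  finally obtain k :: int where k: "(of_nat (M * ?n) / of_nat ?d :: rat) = of_int k"
    by (auto elim: Ints_cases)
  then have "(of_int (int (M * ?n)) :: rat) = of_int (k * int ?d)" using nd by (simp add: field_simps)
  then have "int (M * ?n) = k * int ?d" by (simp only: of_int_eq_iff)
  then have "int ?d dvd int (M * ?n)" by simp
  then have "?d dvd M * ?n" by (simp only: int_dvd_int_iff)
  then have "?d dvd M" using nd by (metis coprime_commute coprime_dvd_mult_left_iff)
  then have "pair_denom ps (Suc i) dvd N" unfolding pair_denom_Suc M by simp
  moreover have "2 ^ i * 2 \<le> ?D * ?d" using Suc.IH i nd by (intro mult_le_mono) auto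
  ultimately show ?case by (simp add: pair_denom_Suc mult.commute)
qed

theorem puiseux_pairs_ex1:
  assumes "puiseux_series a"
  shows "\<exists>!ps. is_puiseux_pairs a ps"
proof -
  obtain N :: nat where N0: "0 < N"
    and N: "\<forall>\<alpha>. a \<alpha> \<noteq> 0 \<longrightarrow> 1 \<le> \<alpha> \<and> of_nat N * \<alpha> \<in> \<int>"
    using assms unfolding puiseux_series_def by blast
  have bound: "length ps < Suc N" if "partial_pairs a ps" for ps
  proof -
    have "pair_denom ps (length ps) dvd N" "2 ^ length ps \<le> pair_denom ps (length ps)"
      using partial_pairs_denom_dvd[OF that N] by auto
    then have "2 ^ length ps \<le> N" using N0 dvd_imp_le le_trans by blast
    moreover have "length ps < 2 ^ length ps" by simp
    ultimately show ?thesis by linarith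
  qed
  have "partial_pairs a []" by (simp add: partial_pairs_def)
  then obtain ps where ps: "partial_pairs a ps"
    and mx: "\<And>qs. partial_pairs a qs \<Longrightarrow> length qs \<le> length ps"
    using ex_has_greatest_nat[of "partial_pairs a" "[]" length "Suc N"] bound
    by (meson less_imp_le)
  have "is_puiseux_pairs a ps"
  proof (rule ccontr)
    assume "\<not> is_puiseux_pairs a ps"
    then have "\<not> (\<forall>\<alpha>. a \<alpha> \<noteq> 0 \<longrightarrow> of_nat (pair_denom ps (length ps)) * \<alpha> \<in> \<int>)"
      using ps unfolding partial_pairs_def is_puiseux_pairs_def by argo
    then have "\<exists>\<alpha>. a \<alpha> \<noteq> 0 \<and> of_nat (pair_denom ps (length ps)) * \<alpha> \<notin> \<int>"
      by blast
    then obtain p where "partial_pairs a (ps @ [p])"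
      using partial_pairs_extend[OF ps N0 N] by blast
    then show False using mx[of "ps @ [p]"] by simp
  qed
  then show ?thesis using is_puiseux_pairs_unique by blast
qed

corollary is_puiseux_pairs_puiseux_pairs:
  "puiseux_series a \<Longrightarrow> is_puiseux_pairs a (puiseux_pairs a)"
  unfolding puiseux_pairs_def by (rule theI'[OF puiseux_pairs_ex1])

end

theory Submission
  imports Defs
begin

text \<open>
  Let \<open>\<xi> > 1\<close> be an exponent outside \<open>(1/D)\<int>\<close> while all exponents of both series below \<open>\<xi>\<close> lie
  in \<open>(1/D)\<int>\<close>, and let \<open>\<phi>\<close> and \<open>\<phi>'\<close> be the truncations of the two series below \<open>\<xi>\<close>.  As
  \<open>y \<rightarrow> 0+\<close>, \<open>f (\<phi>(y) + w y\<^sup>\<xi>, y) \<sim> y\<^sup>m Q(w)\<close>, the lowest weighted form; two monomials \<open>w\<^sup>i\<close> in \<open>Q\<close>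
  have indices differing by a multiple of the denominator of \<open>D \<xi>\<close>, so no two consecutive
  coefficients of \<open>Q\<close> are nonzero.  Likewise for \<open>g\<close>, with \<open>\<phi>'\<close> and \<open>Q'\<close>.  Since \<open>\<sigma>\<close> is strictly
  differentiable at \<open>0\<close> and maps the first arc to the second, it maps the arc \<open>\<lambda>(y) + z y\<^sup>\<xi>\<close> to an
  arc \<open>\<phi>'(y') + (b\<^sub>\<xi> + p z + o(1)) y'\<^sup>\<xi>\<close> with \<open>p \<noteq> 0\<close> and \<open>y' \<sim> c y\<close>.  Hence
  \<open>Q(a\<^sub>\<xi> + z) = C Q'(b\<^sub>\<xi> + p z)\<close>, and both polynomials having vanishing second coefficient forces
  \<open>b\<^sub>\<xi> = p a\<^sub>\<xi>\<close>.  So \<open>a\<^sub>\<xi>\<close> and \<open>b\<^sub>\<xi>\<close> vanish together, and the characteristic exponents agree one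
  after the other.
\<close>

subsection \<open>Polynomials without consecutive nonzero coefficients\<close>

text \<open>Since \<open>[:a, b:] ^ i\<close> has degree at most \<open>i\<close>, only the
  monomials of \<open>Q\<close> of degree \<open>k\<close> and \<open>Suc k\<close> reach the
  coefficient at \<open>k\<close>. This covers both the leading and the second coefficient after an
  affine substitution.\<close>

lemma coeff_pcompose_linear:
  fixes Q :: "'a::comm_semiring_1 poly"
  assumes "degree Q \<le> Suc k"
  shows "coeff (pcompose Q [:a, b:]) k = coeff Q k * b ^ k + coeff Q (Suc k) * of_nat (Suc k) * b ^ k * a"
proof -
  have "Q = (\<Sum>i\<le>Suc k. monom (coeff Q i) i)"
    using poly_as_sum_of_monoms'[OF assms] by simp
  then have "pcompose Q [:a, b:] = pcompose (\<Sum>i\<le>Suc k. monom (coeff Q i) i) [:a, b:]"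
    by simp
  also have "\<dots> = (\<Sum>i\<le>Suc k. smult (coeff Q i) ([:a, b:] ^ i))"
    unfolding pcompose_sum by (simp only: pcompose_altdef map_poly_monom poly_monom
        mult.commute[of _ "_ ^ _"] pCons_0_0) (simp add: mult.commute)
  finally have *: "coeff (pcompose Q [:a, b:]) k = (\<Sum>i\<le>Suc k. coeff Q i * coeff ([:a, b:] ^ i) k)"
    by (simp add: coeff_sum)
  have "degree ([:a, b:] ^ i) < k" if "i < k" for i
    using degree_power_le[of "[:a, b:]" i] that by (auto split: if_splits)
  then have "coeff ([:a, b:] ^ i) k = 0" if "i < k" for i
    using that by (simp add: coeff_eq_0)
  then have "(\<Sum>i<k. coeff Q i * coeff ([:a, b:] ^ i) k) = 0"
    by simp
  then show ?thesis
    unfolding * by (simp add: lessThan_Suc_atMost[symmetric] coeff_linear_poly_power algebra_simps del: power_Suc)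
qed

text \<open>Both sides have the same degree \<open>Suc n\<close>, and the gap condition kills the
  second coefficients of \<open>P\<close> and \<open>Q\<close>. After the substitutions the second
  coefficients come from the leading ones alone, and their quotients by the leading coefficients are
  \<open>Suc n * a\<close> and \<open>Suc n * b / p\<close>.\<close>

lemma affine_conjugate_no_gap:
  fixes P Q :: "real poly"
  assumes gapP: "\<And>i. coeff P (Suc i) \<noteq> 0 \<Longrightarrow> coeff P i = 0"
    and gapQ: "\<And>i. coeff Q (Suc i) \<noteq> 0 \<Longrightarrow> coeff Q i = 0"
    and "P \<noteq> 0" "poly P a = 0" "p \<noteq> 0" "C \<noteq> 0"
    and eq: "\<And>z. poly P (a + z) = C * poly Q (b + p * z)"
  shows "p * a = b"
proof -
  have "pcompose P [:a, 1:] = smult C (pcompose Q [:b, p:])"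
    by (rule poly_eq_poly_eq_iff[THEN iffD1]) (simp add: fun_eq_iff poly_pcompose eq mult.commute[of p])
  moreover from this have "degree P = degree Q"
    using \<open>C \<noteq> 0\<close> \<open>p \<noteq> 0\<close> by (metis degree_pCons_eq_if degree_pcompose degree_smult_eq mult.right_neutral
      one_neq_zero pCons_eq_0_iff degree_0 One_nat_def)
  \<comment> \<open>A nonzero polynomial with a root is not constant, so a second coefficient
    exists.\<close>
  moreover have "degree P \<noteq> 0"
    using assms(3,4) by (metis degree_eq_zeroE mult_zero_right pCons_0_0 poly_0 poly_pCons add.right_neutral)
  then obtain n where n: "degree P = Suc n"
    using not0_implies_Suc by blast
  ultimately have deg: "degree Q = Suc n"
    and *: "coeff (pcompose P [:a, 1:]) n = C * coeff (pcompose Q [:b, p:]) n"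
    and **: "coeff (pcompose P [:a, 1:]) (Suc n) = C * coeff (pcompose Q [:b, p:]) (Suc n)"
    by auto
  have P1: "coeff P (Suc n) \<noteq> 0" and P0: "coeff P n = 0" and Q0: "coeff Q n = 0"
    using gapP[of n] gapQ[of n] n deg leading_coeff_neq_0 degree_0 by (metis Zero_not_Suc)+
  have "coeff P (Suc (Suc n)) = 0" "coeff Q (Suc (Suc n)) = 0"
    using n deg by (simp_all add: coeff_eq_0)
  then have lead: "coeff P (Suc n) = C * (coeff Q (Suc n) * p ^ Suc n)"
    using ** coeff_pcompose_linear[of P "Suc n" a 1] coeff_pcompose_linear[of Q "Suc n" b p] n deg
    by simp
  have "coeff P (Suc n) * of_nat (Suc n) * a = C * (coeff Q (Suc n) * of_nat (Suc n) * p ^ n * b)"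
    using * coeff_pcompose_linear[of P n a 1] coeff_pcompose_linear[of Q n b p] n deg P0 Q0 by simp
  then have "C * coeff Q (Suc n) * p ^ n * of_nat (Suc n) * (p * a - b) = 0"
    unfolding lead by (simp add: algebra_simps)
  moreover have "C * coeff Q (Suc n) * p ^ n * of_nat (Suc n) \<noteq> 0"
    using lead P1 \<open>p \<noteq> 0\<close> by (auto simp del: of_nat_Suc)
  ultimately have "p * a - b = 0" by (metis mult_eq_0_iff)
  then show ?thesis by simp
qed

subsection \<open>Strict differentiability at the origin\<close>

text \<open>Two moving points are compared because neighbouring arcs differ by a multiple of
  \<open>y powr \<xi>\<close>, far less than their distance to the origin: plain differentiability
  at 0 only gives an error o(y), this notion gives o(\<open>y powr \<xi>\<close>). The set
  \<open>S\<close> allows the one-sided case of fractional powers.\<close>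

definition strict_derivative_at_0 ::
  "('a::real_normed_vector \<Rightarrow> 'b::real_normed_vector) \<Rightarrow> ('a \<Rightarrow> 'b) \<Rightarrow> 'a set \<Rightarrow> bool" where
  "strict_derivative_at_0 h L S \<longleftrightarrow> bounded_linear L \<and>
     (\<forall>e>0. \<exists>d>0. \<forall>p\<in>S. \<forall>q\<in>S. norm p < d \<longrightarrow> norm q < d \<longrightarrow>
        norm (h p - h q - L (p - q)) \<le> e * norm (p - q))"

text \<open>The error is at most a small multiple of \<open>norm (p t - q t)\<close>, which is of
  order \<open>s t\<close>. It is applied with the scale \<open>s\<close> equal to \<open>y\<close>
  and to \<open>y powr \<xi>\<close>.\<close>

lemma strict_derivative_tendsto:
  assumes h: "strict_derivative_at_0 h L S"
    and p: "(p \<longlongrightarrow> 0) F" "\<forall>\<^sub>F t in F. p t \<in> S"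
    and q: "(q \<longlongrightarrow> 0) F" "\<forall>\<^sub>F t in F. q t \<in> S"
    and s: "\<forall>\<^sub>F t in F. 0 < s t"
    and v: "((\<lambda>t. (p t - q t) /\<^sub>R s t) \<longlongrightarrow> v) F"
  shows "((\<lambda>t. (h (p t) - h (q t)) /\<^sub>R s t) \<longlongrightarrow> L v) F"
proof -
  interpret L: bounded_linear L using h unfolding strict_derivative_at_0_def by blast
  let ?u = "\<lambda>t. (p t - q t) /\<^sub>R s t"
  have "((\<lambda>t. (h (p t) - h (q t)) /\<^sub>R s t - L (?u t)) \<longlongrightarrow> 0) F"
  proof (rule tendstoI)
    fix e :: real assume "0 < e"
    define e' where "e' = e / (norm v + 2)"
    have "0 < norm v + 2" by (simp add: add_nonneg_pos)
    then have e': "0 < e'" "e' * (norm v + 1) < e" using \<open>0 < e\<close>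
      unfolding e'_def by (simp_all add: field_simps)
    from h e'(1) obtain d where d: "0 < d"
      "\<And>x y. x \<in> S \<Longrightarrow> y \<in> S \<Longrightarrow> norm x < d \<Longrightarrow> norm y < d \<Longrightarrow>
        norm (h x - h y - L (x - y)) \<le> e' * norm (x - y)"
      unfolding strict_derivative_at_0_def by blast
    have "\<forall>\<^sub>F t in F. norm (p t) < d" "\<forall>\<^sub>F t in F. norm (q t) < d"
      using p(1) q(1) d(1) by (auto dest: tendstoD)
    moreover have "\<forall>\<^sub>F t in F. norm (?u t) < norm v + 1"
      using tendsto_norm[OF v] by (rule order_tendstoD) simp
    ultimately show "\<forall>\<^sub>F t in F. dist ((h (p t) - h (q t)) /\<^sub>R s t - L (?u t)) 0 < e"
      using s p(2) q(2)
    proof eventually_elim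
      case (elim t)
      have "norm ((h (p t) - h (q t)) /\<^sub>R s t - L (?u t))
              = norm (h (p t) - h (q t) - L (p t - q t)) / s t"
        using elim by (simp add: L.scaleR scaleR_diff_right[symmetric] divide_inverse mult.commute)
      also have "\<dots> \<le> e' * norm (p t - q t) / s t"
        using d(2)[of "p t" "q t"] elim by (intro divide_right_mono) auto
      also have "\<dots> = e' * norm (?u t)" using elim by (simp add: divide_inverse mult_ac)
      also have "\<dots> \<le> e' * (norm v + 1)" using elim e' by (intro mult_left_mono) auto
      also have "\<dots> < e" by (rule e')
      finally show ?case by simp
    qed
  qed
  from tendsto_add[OF this L.tendsto[OF v]] show ?thesis by simp
qed

text \<open>The mean value inequality for \<open>h - L\<close> on the convex set of points of
  \<open>S\<close> near 0.\<close>

lemma strict_derivativeI: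
  fixes h :: "'a::real_normed_vector \<Rightarrow> 'b::real_normed_vector"
  assumes L: "bounded_linear L" and "convex S"
    and h': "\<And>e. 0 < e \<Longrightarrow> \<exists>d>0. \<forall>p\<in>S. norm p < d \<longrightarrow>
          (h has_derivative h' p) (at p) \<and> onorm (\<lambda>v. h' p v - L v) \<le> e"
  shows "strict_derivative_at_0 h L S"
  unfolding strict_derivative_at_0_def
proof (intro conjI allI impI L)
  fix e :: real assume "0 < e"
  from h'[OF this] obtain d where d: "0 < d"
    "\<And>p. p \<in> S \<Longrightarrow> norm p < d \<Longrightarrow> (h has_derivative h' p) (at p)"
    "\<And>p. p \<in> S \<Longrightarrow> norm p < d \<Longrightarrow> onorm (\<lambda>v. h' p v - L v) \<le> e"
    by blast
  have cv: "convex (S \<inter> ball 0 d)" using \<open>convex S\<close> by (simp add: convex_Int)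
  have "norm (h p - h q - L (p - q)) \<le> e * norm (p - q)"
    if "p \<in> S" "q \<in> S" "norm p < d" "norm q < d" for p q
  proof -
    interpret L: bounded_linear L by (rule L)
    have "norm ((h p - L p) - (h q - L q)) \<le> e * norm (p - q)"
    proof (rule differentiable_bound[OF cv, where f' = "\<lambda>p v. h' p v - L v"])
      fix x assume "x \<in> S \<inter> ball 0 d"
      then show "((\<lambda>x. h x - L x) has_derivative (\<lambda>v. h' x v - L v)) (at x within S \<inter> ball 0 d)"
        using d(2)[of x]
        by (auto intro: has_derivative_diff has_derivative_at_withinI bounded_linear_imp_has_derivative[OF L])
      show "onorm (\<lambda>v. h' x v - L v) \<le> e"
        using d(3)[of x] \<open>x \<in> S \<inter> ball 0 d\<close> by auto
    qed (use that in auto)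
    then show ?thesis by (simp add: L.diff algebra_simps)
  qed
  then show "\<exists>d>0. \<forall>p\<in>S. \<forall>q\<in>S. norm p < d \<longrightarrow> norm q < d \<longrightarrow>
      norm (h p - h q - L (p - q)) \<le> e * norm (p - q)"
    using d(1) by blast
qed

text \<open>Continuity of the derivative at 0 gives the uniform bound. \<open>UNIV\<close> is
  possible because only points near 0 matter, and these lie in \<open>U\<close>.\<close>

lemma C1_on_strict_derivative:
  fixes h :: "'a::real_normed_vector \<Rightarrow> 'b::real_normed_vector"
  assumes "open U" "0 \<in> U" "C1_on U h"
  obtains L where "(h has_derivative L) (at 0)" "strict_derivative_at_0 h L UNIV"
proof -
  from assms(3) obtain h' :: "'a \<Rightarrow> 'a \<Rightarrow>\<^sub>L 'b"
    where h': "\<And>p. p \<in> U \<Longrightarrow> (h has_derivative blinfun_apply (h' p)) (at p)"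
      and cont: "continuous_on U h'"
    unfolding C1_on_def by blast
  have "strict_derivative_at_0 h (blinfun_apply (h' 0)) UNIV"
  proof (rule strict_derivativeI)
    fix e :: real assume "0 < e"
    have "isCont h' 0" using assms cont by (simp add: continuous_on_eq_continuous_at)
    then have "\<forall>\<^sub>F p in nhds 0. dist (h' p) (h' 0) < e"
      using \<open>0 < e\<close> by (simp add: isCont_def tendsto_at_iff_tendsto_nhds tendstoD)
    moreover have "\<forall>\<^sub>F p in nhds 0. p \<in> U" using assms by (simp add: eventually_nhds_in_open)
    ultimately have "\<forall>\<^sub>F p in nhds 0. p \<in> U \<and> dist (h' p) (h' 0) < e" by eventually_elim simp
    then obtain d where "0 < d" "\<And>p. norm p < d \<Longrightarrow> p \<in> U \<and> norm (h' p - h' 0) < e"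
      unfolding eventually_nhds_metric by (auto simp: dist_norm)
    then show "\<exists>d>0. \<forall>p\<in>UNIV. norm p < d \<longrightarrow> (h has_derivative blinfun_apply (h' p)) (at p) \<and>
        onorm (\<lambda>v. h' p v - h' 0 v) \<le> e"
      using h' by (intro exI[of _ d])
        (auto simp: norm_blinfun.rep_eq minus_blinfun.rep_eq fun_diff_def less_imp_le)
  qed (simp_all add: blinfun.bounded_linear_right)
  with h'[OF assms(2)] show thesis by (rule that)
qed

lemma tendsto_powr_at_right_0:
  fixes u :: "'a \<Rightarrow> real"
  assumes "filterlim u (at_right 0) F" "0 < b"
  shows "((\<lambda>t. u t powr b) \<longlongrightarrow> 0) F"
  using assms by (intro tendsto_zero_powrI[where b = b]) (auto simp: filterlim_at elim: eventually_mono)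

text \<open>Truncations of Puiseux series with exponents in (1/D)Z, all at least 1, have this shape.
  The derivative on the positive half-line extends continuously to 0, with value
  \<open>poly R 0\<close>.\<close>

lemma fractional_poly_strict_derivative:
  fixes R :: "real poly"
  assumes "0 < D"
  shows "strict_derivative_at_0 (\<lambda>v. v * poly R (v powr (1 / real D))) (\<lambda>v. v * poly R 0) {0<..}"
proof -
  let ?\<beta> = "1 / real D"
  \<comment> \<open>This is the derivative by the product rule; the factor \<open>v\<close> absorbs
    the singular power \<open>v powr (1 / D - 1)\<close> from the chain rule.\<close>
  define k where "k = (\<lambda>v. poly R (v powr ?\<beta>) + ?\<beta> * v powr ?\<beta> * poly (pderiv R) (v powr ?\<beta>))"
  have lim: "((\<lambda>v::real. v powr ?\<beta>) \<longlongrightarrow> 0) (at_right 0)"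
    using assms by (intro tendsto_powr_at_right_0 filterlim_ident) simp
  then have "(k \<longlongrightarrow> poly R 0 + ?\<beta> * 0 * poly (pderiv R) 0) (at_right 0)"
    unfolding k_def by (intro tendsto_intros tendsto_poly)
  then have k: "(k \<longlongrightarrow> poly R 0) (at_right 0)" by simp
  show ?thesis
  proof (rule strict_derivativeI)
    fix e :: real assume "0 < e"
    then obtain d where d: "0 < d" "\<And>v. 0 < v \<Longrightarrow> v < d \<Longrightarrow> \<bar>k v - poly R 0\<bar> < e"
      using tendstoD[OF k \<open>0 < e\<close>] by (auto simp: eventually_at_right_field dist_real_def)
    have "((\<lambda>v. v * poly R (v powr ?\<beta>)) has_derivative (\<lambda>h. h * k v)) (at v)" if "0 < v" for v
    proof -
      have "((\<lambda>v. v * poly R (v powr ?\<beta>)) has_field_derivative k v) (at v)"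
        unfolding k_def using that
        by (auto intro!: derivative_eq_intros DERIV_chain2[OF poly_DERIV]
            simp: powr_diff field_simps)
      then show ?thesis by (simp add: has_field_derivative_def mult.commute[of _ "k v"])
    qed
    moreover have "onorm (\<lambda>h. h * k v - h * poly R 0) \<le> e" if "0 < v" "v < d" for v
      using d(2)[OF that] by (intro onorm_bound)
       (auto simp: right_diff_distrib[symmetric] abs_mult mult.commute[of e] intro!: mult_left_mono)
    ultimately show "\<exists>d>0. \<forall>p\<in>{0<..}. norm p < d \<longrightarrow>
        ((\<lambda>v. v * poly R (v powr ?\<beta>)) has_derivative (\<lambda>h. h * k p)) (at p) \<and>
        onorm (\<lambda>h. h * k p - h * poly R 0) \<le> e"
      using d(1) by (intro exI[of _ d]) auto
  qed (auto intro: bounded_linear_mult_left convex_real_interval)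
qed

subsection \<open>Truncation of fractional power series\<close>

lemma Ints_of_nat_mult_nonneg:
  fixes \<alpha> :: rat
  assumes "of_nat D * \<alpha> \<in> \<int>" "0 \<le> \<alpha>"
  shows "of_nat (nat \<lfloor>of_nat D * \<alpha>\<rfloor>) = of_nat D * \<alpha>"
  using assms by (metis floor_of_int Ints_cases of_nat_nat mult_nonneg_nonneg of_nat_0_le_iff zero_le_floor)

text \<open>The finitely many terms below \<xi> form \<open>y * poly R (y powr (1 / D))\<close>, the
  term at \<xi> gives the limit, and the later exponents stay away from \<xi> because they have a
  common denominator.\<close>

lemma puiseux_truncation:
  fixes \<xi> :: rat
  assumes a: "puiseux_series a" and "0 < D"
    and D: "\<And>\<alpha>. a \<alpha> \<noteq> 0 \<Longrightarrow> \<alpha> < \<xi> \<Longrightarrow> of_nat D * \<alpha> \<in> \<int>"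
  obtains R :: "real poly" where
    "((\<lambda>y. (puiseux_value a y - y * poly R (y powr (1 / real D))) / y powr real_of_rat \<xi>)
       \<longlongrightarrow> a \<xi>) (at_right 0)"
proof -
  from a obtain N :: nat where N: "0 < N" "\<And>\<alpha>. a \<alpha> \<noteq> 0 \<Longrightarrow> 1 \<le> \<alpha> \<and> of_nat N * \<alpha> \<in> \<int>"
    unfolding puiseux_series_def by blast
  from a obtain \<delta> where \<delta>: "0 < \<delta>"
    "\<And>y. y \<in> {0..<\<delta>} \<Longrightarrow> (\<lambda>\<alpha>. a \<alpha> * y powr real_of_rat \<alpha>) summable_on UNIV"
    unfolding puiseux_series_def by blast
  define A where "A = {\<alpha>. a \<alpha> \<noteq> 0 \<and> \<alpha> < \<xi>}"
  define B where "B = {\<alpha>. a \<alpha> \<noteq> 0 \<and> \<xi> < \<alpha>}"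
  \<comment> \<open>Chosen so that
    \<open>y * (y powr (1 / D)) ^ e \<alpha> = y powr \<alpha>\<close>. On \<open>A\<close> neither
    the floor nor the natural subtraction loses anything, as D \<alpha> is an integer and \<alpha>
    \<ge> 1.\<close>
  define e where "e \<alpha> = nat \<lfloor>of_nat D * \<alpha>\<rfloor> - D" for \<alpha> :: rat
  define R where "R = (\<Sum>\<alpha>\<in>A. monom (a \<alpha>) (e \<alpha>))"
  have eA: "of_nat (e \<alpha>) = of_nat D * \<alpha> - of_nat D" if "\<alpha> \<in> A" for \<alpha>
  proof -
    have "1 \<le> \<alpha>" using that N(2) by (auto simp: A_def)
    moreover have *: "of_nat (nat \<lfloor>of_nat D * \<alpha>\<rfloor>) = of_nat D * \<alpha>"
      using that D[of \<alpha>] calculation by (intro Ints_of_nat_mult_nonneg) (auto simp: A_def)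
    ultimately have "(of_nat D :: rat) \<le> of_nat (nat \<lfloor>of_nat D * \<alpha>\<rfloor>)"
      unfolding * using mult_left_mono[of 1 \<alpha> "of_nat D"] by simp
    then have "D \<le> nat \<lfloor>of_nat D * \<alpha>\<rfloor>" by (simp only: of_nat_le_iff)
    then show ?thesis unfolding e_def by (simp only: of_nat_diff *)
  qed
  have finA: "finite A"
  proof (rule finite_subset)
    show "A \<subseteq> (\<lambda>k. of_nat k / of_nat D) ` {..nat \<lfloor>of_nat D * \<xi>\<rfloor>}"
    proof
      fix \<alpha> assume \<alpha>: "\<alpha> \<in> A"
      then have 0: "0 \<le> \<alpha>" "of_nat D * \<alpha> \<in> \<int>" "\<alpha> \<le> \<xi>"
        using N(2)[of \<alpha>] D[of \<alpha>] by (auto simp: A_def)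
      then have "nat \<lfloor>of_nat D * \<alpha>\<rfloor> \<le> nat \<lfloor>of_nat D * \<xi>\<rfloor>"
        by (intro nat_mono floor_mono mult_left_mono) auto
      moreover have "\<alpha> = of_nat (nat \<lfloor>of_nat D * \<alpha>\<rfloor>) / of_nat D"
        using \<open>0 < D\<close> Ints_of_nat_mult_nonneg[OF 0(2,1)] by simp
      ultimately show "\<alpha> \<in> (\<lambda>k. of_nat k / of_nat D) ` {..nat \<lfloor>of_nat D * \<xi>\<rfloor>}" by blast
    qed
  qed simp
  have head: "y * poly R (y powr (1 / real D)) = (\<Sum>\<alpha>\<in>A. a \<alpha> * y powr real_of_rat \<alpha>)" if "0 < y" for y
  proof -
    have "y * (y powr (1 / real D)) ^ e \<alpha> = y powr real_of_rat \<alpha>" if "\<alpha> \<in> A" for \<alpha>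
    proof -
      have "real (e \<alpha>) = real_of_rat (of_nat (e \<alpha>))" by simp
      also have "\<dots> = real D * real_of_rat \<alpha> - real D"
        unfolding eA[OF that] by (simp add: of_rat_diff of_rat_mult)
      finally have "1 + real (e \<alpha>) / real D = real_of_rat \<alpha>" using \<open>0 < D\<close> by (simp add: field_simps)
      moreover have "y * (y powr (1 / real D)) ^ e \<alpha> = y powr (1 + real (e \<alpha>) / real D)"
        using \<open>0 < y\<close> by (simp add: powr_add powr_power)
      ultimately show ?thesis by simp
    qed
    then show ?thesis
      unfolding R_def by (auto simp: poly_sum poly_monom sum_distrib_left mult.left_commute intro!: sum.cong)
  qed
  \<comment> \<open>Take for \<beta> the least exponent beyond \<xi>, or \<open>\<xi> + 1\<close> if
    there is none.\<close>
  have "\<exists>\<beta>>\<xi>. \<forall>\<alpha>\<in>B. \<beta> \<le> \<alpha>"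
  proof (cases "B = {}")
    case True
    then show ?thesis by (auto intro: exI[of _ "\<xi> + 1"])
  next
    case False
    obtain \<beta> where "\<beta> \<in> B" "\<And>\<alpha>. \<alpha> \<in> B \<Longrightarrow> \<beta> \<le> \<alpha>"
      by (rule frac_exponents_least[OF N(1) False]) (use N(2) in \<open>auto simp: B_def\<close>)
    then show ?thesis by (auto simp: B_def)
  qed
  then obtain \<beta> where \<beta>: "\<xi> < \<beta>" "\<And>\<alpha>. \<alpha> \<in> B \<Longrightarrow> \<beta> \<le> \<alpha>" by blast
  define z where "z = \<delta> / 2"
  have z: "0 < z" "z < \<delta>" using \<delta>(1) by (simp_all add: z_def)
  \<comment> \<open>For y \<le> z and \<alpha> \<ge> \<beta>, \<open>y powr (\<alpha> - \<beta>)
    \<le> z powr (\<alpha> - \<beta>)\<close>, so the tail at \<open>y\<close> is bounded by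
    \<open>(y / z) powr \<beta>\<close> times the absolute tail at the fixed point
    \<open>z\<close>.\<close>
  define C where "C = z powr - real_of_rat \<beta> * (\<Sum>\<^sub>\<infinity>\<alpha>\<in>B. \<bar>a \<alpha>\<bar> * z powr real_of_rat \<alpha>)"
  let ?tail = "\<lambda>y. \<Sum>\<^sub>\<infinity>\<alpha>\<in>B. a \<alpha> * y powr real_of_rat \<alpha>"
  have abs: "(\<lambda>\<alpha>. \<bar>a \<alpha>\<bar> * y powr real_of_rat \<alpha>) summable_on B" if "0 < y" "y < \<delta>" for y
    using \<delta>(2)[of y] that summable_on_iff_abs_summable_on_real[of "\<lambda>\<alpha>. a \<alpha> * y powr real_of_rat \<alpha>" UNIV]
    by (auto simp: abs_mult intro: summable_on_subset_banach[of _ UNIV])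
  have tail: "\<bar>?tail y\<bar> \<le> C * y powr real_of_rat \<beta>" if y: "0 < y" "y \<le> z" for y
  proof -
    have "\<bar>?tail y\<bar> \<le> (\<Sum>\<^sub>\<infinity>\<alpha>\<in>B. \<bar>a \<alpha>\<bar> * y powr real_of_rat \<alpha>)"
      using norm_infsum_bound[of "\<lambda>\<alpha>. a \<alpha> * y powr real_of_rat \<alpha>" B] abs[of y] y z
      by (simp add: abs_mult)
    also have "\<dots> \<le> (\<Sum>\<^sub>\<infinity>\<alpha>\<in>B. y powr real_of_rat \<beta> * z powr - real_of_rat \<beta> * (\<bar>a \<alpha>\<bar> * z powr real_of_rat \<alpha>))"
    proof (rule infsum_mono)
      fix \<alpha> assume "\<alpha> \<in> B"
      then have "0 \<le> real_of_rat \<alpha> - real_of_rat \<beta>" using \<beta>(2) by (simp add: of_rat_less_eq)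
      then have "y powr (real_of_rat \<alpha> - real_of_rat \<beta>) \<le> z powr (real_of_rat \<alpha> - real_of_rat \<beta>)"
        using y by (intro powr_mono2) auto
      then have "y powr real_of_rat \<beta> * y powr (real_of_rat \<alpha> - real_of_rat \<beta>)
          \<le> y powr real_of_rat \<beta> * z powr (real_of_rat \<alpha> - real_of_rat \<beta>)"
        by (intro mult_left_mono) auto
      then have "y powr real_of_rat \<alpha> \<le> y powr real_of_rat \<beta> * z powr - real_of_rat \<beta> * z powr real_of_rat \<alpha>"
        using y z by (simp add: powr_add[symmetric] mult.assoc)
      from mult_left_mono[OF this abs_ge_zero[of "a \<alpha>"]]
      show "\<bar>a \<alpha>\<bar> * y powr real_of_rat \<alpha>
          \<le> y powr real_of_rat \<beta> * z powr - real_of_rat \<beta> * (\<bar>a \<alpha>\<bar> * z powr real_of_rat \<alpha>)"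
        by (simp add: mult_ac)
    qed (use abs y z in \<open>auto intro!: summable_on_cmult_right\<close>)
    also have "\<dots> = C * y powr real_of_rat \<beta>"
      unfolding C_def by (subst infsum_cmult_right') simp
    finally show ?thesis .
  qed
  have split: "(puiseux_value a y - y * poly R (y powr (1 / real D))) / y powr real_of_rat \<xi>
      = a \<xi> + ?tail y / y powr real_of_rat \<xi>" if y: "0 < y" "y \<le> z" for y
  proof -
    let ?g = "\<lambda>\<alpha>. a \<alpha> * y powr real_of_rat \<alpha>"
    have "puiseux_value a y = infsum ?g (insert \<xi> A \<union> B)"
      unfolding puiseux_value_def by (rule infsum_cong_neutral) (auto simp: A_def B_def)
    also have "\<dots> = infsum ?g (insert \<xi> A) + infsum ?g B"
      using \<delta>(2)[of y] y z finA by (intro infsum_Un_disjoint)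
        (auto intro: summable_on_subset_banach simp: A_def B_def)
    also have "infsum ?g (insert \<xi> A) = ?g \<xi> + y * poly R (y powr (1 / real D))"
      using finA head[OF y(1)] by (subst infsum_finite) (auto simp: A_def)
    finally show ?thesis using y by (simp add: field_simps)
  qed
  have small: "\<forall>\<^sub>F y in at_right 0. 0 < y \<and> y \<le> z"
    using z by (auto simp: eventually_at_right_field intro: exI[of _ z])
  have "((\<lambda>y. ?tail y / y powr real_of_rat \<xi>) \<longlongrightarrow> 0) (at_right 0)"
  proof (rule Lim_null_comparison)
    show "\<forall>\<^sub>F y in at_right 0. norm (?tail y / y powr real_of_rat \<xi>)
        \<le> C * y powr (real_of_rat \<beta> - real_of_rat \<xi>)"
      using small
    proof eventually_elim
      case (elim y)
      then show ?case using tail[of y] by (simp add: powr_diff divide_right_mono)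
    qed
    have "((\<lambda>y. y powr (real_of_rat \<beta> - real_of_rat \<xi>)) \<longlongrightarrow> 0) (at_right 0)"
      using \<beta>(1) by (intro tendsto_powr_at_right_0 filterlim_ident) (simp add: of_rat_less)
    then show "((\<lambda>y. C * y powr (real_of_rat \<beta> - real_of_rat \<xi>)) \<longlongrightarrow> 0) (at_right 0)"
      by (rule tendsto_mult_right_zero)
  qed
  from tendsto_add[OF tendsto_const[of "a \<xi>"] this]
  have "((\<lambda>y. (puiseux_value a y - y * poly R (y powr (1 / real D))) / y powr real_of_rat \<xi>)
       \<longlongrightarrow> a \<xi>) (at_right 0)"
    using small split by (auto elim!: Lim_transform_eventually elim: eventually_mono)
  then show thesis by (rule that)
qed

subsection \<open>The leading form of an analytic germ along an arc\<close>

text \<open>Every index outside the square has i + j \<ge> K + 1, so its term is at most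
  \<open>(\<rho> / q) ^ Suc K\<close> times its absolute value at the point (q, q), q = r/2, where
  the series converges absolutely.\<close>

lemma double_series_remainder:
  fixes f :: "real \<times> real \<Rightarrow> real"
  assumes "0 < r" and sums: "\<And>x y. \<bar>x\<bar> < r \<Longrightarrow> \<bar>y\<bar> < r \<Longrightarrow>
        ((\<lambda>(i, j). c (i, j) * x ^ i * y ^ j) has_sum f (x, y)) UNIV"
  obtains C where "\<And>x y \<rho>. \<bar>x\<bar> \<le> \<rho> \<Longrightarrow> \<bar>y\<bar> \<le> \<rho> \<Longrightarrow> \<rho> \<le> r / 2 \<Longrightarrow>
     \<bar>f (x, y) - (\<Sum>(i, j)\<in>{..K} \<times> {..K}. c (i, j) * x ^ i * y ^ j)\<bar> \<le> C * \<rho> ^ Suc K"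
proof -
  define q where "q = r / 2"
  have q: "0 < q" "q < r" using \<open>0 < r\<close> by (simp_all add: q_def)
  let ?A = "{..K} \<times> {..K}"
  have "(\<lambda>(i, j). c (i, j) * q ^ i * q ^ j) summable_on UNIV"
    using sums[of q q] q by (auto simp: summable_on_def)
  then have "(\<lambda>ij. norm ((\<lambda>(i, j). c (i, j) * q ^ i * q ^ j) ij)) summable_on - ?A"
    by (rule summable_on_subset_banach[OF summable_on_iff_abs_summable_on_real[THEN iffD1]]) simp
  then have summ: "(\<lambda>(i, j). \<bar>c (i, j)\<bar> * q ^ (i + j)) summable_on - ?A"
    using q by (simp add: case_prod_unfold abs_mult power_add mult.assoc)
  define S where "S = (\<Sum>\<^sub>\<infinity>(i, j)\<in>- ?A. \<bar>c (i, j)\<bar> * q ^ (i + j))"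
  show thesis
  proof (rule that[of "S / q ^ Suc K"])
    fix x y \<rho> assume xy: "\<bar>x\<bar> \<le> \<rho>" "\<bar>y\<bar> \<le> \<rho>" "\<rho> \<le> r / 2"
    let ?g = "\<lambda>(i, j). c (i, j) * x ^ i * y ^ j"
    have \<rho>: "0 \<le> \<rho>" "\<rho> \<le> q" "\<rho> < r" using xy \<open>0 < r\<close> by (auto simp: q_def)
    have hs: "(?g has_sum f (x, y)) UNIV" using sums[of x y] xy \<rho> by simp
    have summg: "?g summable_on - ?A"
      by (rule summable_on_subset_banach[of _ UNIV]) (use hs in \<open>auto simp: summable_on_def\<close>)
    have "f (x, y) = infsum ?g (?A \<union> - ?A)" using infsumI[OF hs] by simp
    also have "\<dots> = sum ?g ?A + infsum ?g (- ?A)"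
      by (subst infsum_Un_disjoint) (use summg in auto)
    finally have "\<bar>f (x, y) - sum ?g ?A\<bar> = \<bar>infsum ?g (- ?A)\<bar>" by simp
    also have "\<dots> \<le> (\<Sum>\<^sub>\<infinity>ij\<in>- ?A. norm (?g ij))"
      using norm_infsum_bound[of ?g "- ?A"] summg summable_on_iff_abs_summable_on_real by force
    also have "\<dots> \<le> (\<Sum>\<^sub>\<infinity>ij\<in>- ?A. (\<rho> / q) ^ Suc K * (\<lambda>(i, j). \<bar>c (i, j)\<bar> * q ^ (i + j)) ij)"
    proof (rule infsum_mono)
      fix ij assume "ij \<in> - ?A"
      then obtain i j where ij: "ij = (i, j)" "Suc K \<le> i + j" by (cases ij) auto
      have "\<bar>x\<bar> ^ i * \<bar>y\<bar> ^ j \<le> \<rho> ^ i * \<rho> ^ j"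
        using xy \<rho> by (intro mult_mono power_mono) auto
      also have "\<dots> = q ^ (i + j) * (\<rho> / q) ^ (i + j)"
        using q by (simp add: power_add power_divide)
      also have "\<dots> \<le> q ^ (i + j) * (\<rho> / q) ^ Suc K"
        using q \<rho> ij by (intro mult_left_mono power_decreasing) auto
      finally have "\<bar>x\<bar> ^ i * \<bar>y\<bar> ^ j \<le> q ^ (i + j) * (\<rho> / q) ^ Suc K" .
      from mult_left_mono[OF this abs_ge_zero[of "c (i, j)"]]
      show "norm (?g ij) \<le> (\<rho> / q) ^ Suc K * (\<lambda>(i, j). \<bar>c (i, j)\<bar> * q ^ (i + j)) ij"
        unfolding ij by (simp add: abs_mult power_abs mult_ac)
    next
      show "(\<lambda>ij. norm (?g ij)) summable_on - ?A"
        using summg summable_on_iff_abs_summable_on_real by blast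
    qed (intro summable_on_cmult_right summ)
    also have "\<dots> = S / q ^ Suc K * \<rho> ^ Suc K"
      unfolding S_def by (subst infsum_cmult_right') (simp add: power_divide)
    finally show "\<bar>f (x, y) - sum ?g ?A\<bar> \<le> S / q ^ Suc K * \<rho> ^ Suc K" .
  qed
qed

text \<open>
  The truncated double series with coefficients \<open>c\<close> after the substitution \<open>y = s\<^sup>D\<close>,
  \<open>x = s\<^sup>D R(s) + X\<close>, as a polynomial in \<open>X\<close> with coefficients in \<open>\<real>[s]\<close>.
\<close>

definition shifted_poly :: "(nat \<times> nat \<Rightarrow> real) \<Rightarrow> nat \<Rightarrow> real poly \<Rightarrow> nat \<Rightarrow> real poly poly" where
  "shifted_poly c D R K =
     (\<Sum>(i, j)\<in>{..K} \<times> {..K}. smult (monom (c (i, j)) (D * j)) ([:monom 1 D * R, 1:] ^ i))"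

lemma poly_shifted_poly:
  "poly (poly (shifted_poly c D R K) [:X:]) s =
     (\<Sum>(i, j)\<in>{..K} \<times> {..K}. c (i, j) * (s ^ D * poly R s + X) ^ i * (s ^ D) ^ j)"
  unfolding shifted_poly_def poly_sum
  by (intro sum.cong) (simp_all add: case_prod_beta poly_monom power_mult mult.assoc mult.commute[of "(s ^ D) ^ _"])

text \<open>Exhibits a coefficient that survives the substitution and is the same for all large
  \<open>K\<close>. A term with index (i, j) contributes to \<open>X ^ p\<close> only if p \<le> i;
  then it carries \<open>s ^ (D * j)\<close>, and a further factor \<open>s ^ D\<close> if p < i.
  Order exactly \<open>D * k\<close> thus leaves only (p, k).\<close>

lemma coeff_shifted_poly:
  assumes min: "\<And>i j. j < k \<Longrightarrow> c (i, j) = 0" and "p \<le> K" "k \<le> K" "0 < D"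
  shows "coeff (coeff (shifted_poly c D R K) p) (D * k) = c (p, k)"
proof -
  have "coeff (coeff (smult (monom (c (i, j)) (D * j)) ([:monom 1 D * R, 1:] ^ i)) p) (D * k)
      = (if (i, j) = (p, k) then c (i, j) else 0)" (is "?l i j = _") for i j
  proof -
    consider "j < k" | "k \<le> j" "i < p" | "k \<le> j" "i = p" | "k \<le> j" "p < i" by linarith
    then show ?thesis
    proof cases
      case 1
      then show ?thesis using min by simp
    next
      case 2
      have "degree ([:monom 1 D * R, 1:] ^ i) < p"
        using 2 degree_power_le[of "[:monom 1 D * R, 1:]" i] by simp
      then show ?thesis using 2 by (simp add: coeff_eq_0)
    next
      case 3
      then show ?thesis using \<open>0 < D\<close> by (simp add: coeff_linear_poly_power)
    next
      case 4
      \<comment> \<open>With p < i at least one factor \<open>monom 1 D * R\<close> is chosen;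
        splitting it off shows divisibility by \<open>s ^ (D * Suc j)\<close>, of order above
        \<open>D * k\<close>.\<close>
      define m where "m = i - p - 1"
      have m: "i - p = Suc m" using 4 by (simp add: m_def)
      have "monom (c (i, j)) (D * j) * (of_nat (i choose p) * (monom 1 D * R) ^ (i - p))
        = monom 1 (D * Suc j) * ([:c (i, j):] * of_nat (i choose p) * R * (monom 1 D * R) ^ m)"
        unfolding m by (simp add: monom_altdef power_add mult_ac)
      moreover have "D * k < D * Suc j" using 4 \<open>0 < D\<close>
        by (simp only: mult_less_cancel1) simp
      ultimately have "?l i j = 0"
        using 4 by (simp add: coeff_linear_poly_power coeff_monom_mult del: mult_Suc_right)
      then show ?thesis using 4 by simp
    qed
  qed
  then have "coeff (coeff (shifted_poly c D R K) p) (D * k)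
      = (\<Sum>(i, j)\<in>{..K} \<times> {..K}. if (i, j) = (p, k) then c (i, j) else 0)"
    unfolding shifted_poly_def coeff_sum by (intro sum.cong) auto
  also have "\<dots> = c (p, k)"
    using assms(2,3) by (subst sum.mono_neutral_right[of _ "{(p, k)}"]) (auto split: if_splits)
  finally show ?thesis .
qed

lemma poly_poly_eq_sum:
  fixes F :: "'a::comm_ring_1 poly poly"
  obtains B where "finite B" "\<And>i k. (i, k) \<in> B \<longleftrightarrow> coeff (coeff F i) k \<noteq> 0"
    "\<And>X s. poly (poly F [:X:]) s = (\<Sum>(i, k)\<in>B. coeff (coeff F i) k * X ^ i * s ^ k)"
proof -
  let ?S = "SIGMA i:{..degree F}. {..degree (coeff F i)}"
  define B where "B = {(i, k)\<in>?S. coeff (coeff F i) k \<noteq> 0}"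
  have "finite B" unfolding B_def by (rule finite_subset[of _ ?S]) auto
  moreover have "(i, k) \<in> B \<longleftrightarrow> coeff (coeff F i) k \<noteq> 0" for i k
    using le_degree[of "coeff F i" k] le_degree[of F i] by (cases "coeff F i = 0") (auto simp: B_def)
  moreover have "poly (poly F [:X:]) s = (\<Sum>(i, k)\<in>B. coeff (coeff F i) k * X ^ i * s ^ k)" for X s
  proof -
    have "poly (poly F [:X:]) s = (\<Sum>i\<le>degree F. poly (coeff F i) s * X ^ i)"
      by (simp add: poly_altdef[of F] poly_sum poly_const_pow mult.commute)
    also have "\<dots> = (\<Sum>(i, k)\<in>?S. coeff (coeff F i) k * X ^ i * s ^ k)"
      by (simp add: poly_altdef[of "coeff F _"] sum_distrib_left sum.Sigma mult_ac)
    also have "\<dots> = (\<Sum>(i, k)\<in>B. coeff (coeff F i) k * X ^ i * s ^ k)"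
      by (rule sum.mono_neutral_right) (auto simp: B_def)
    finally show ?thesis .
  qed
  ultimately show thesis by (rule that)
qed

text \<open>After substitution \<open>X\<close> has weight \<xi> and \<open>s\<close> has weight
  1/D; \<open>m\<close> is the least weight that occurs and \<open>Q\<close> collects its monomials.
  The parameter \<open>u\<close> and the filter are arbitrary, since on the side of \<open>g\<close>
  the second coordinate of an image arc is itself a function of \<open>y\<close>.\<close>

lemma analytic_germ_leading_form:
  fixes R :: "real poly" and \<xi> :: real
  assumes f: "analytic_germ f" "\<not> (\<forall>\<^sub>F p in nhds 0. f p = 0)"
    and "0 < D" "1 < \<xi>" "real D * \<xi> \<notin> \<int>"
  obtains m :: real and Q :: "real poly" where
    "Q \<noteq> 0" "\<And>i. coeff Q (Suc i) \<noteq> 0 \<Longrightarrow> coeff Q i = 0"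
    "\<And>(F :: 'b filter) u w w0. filterlim u (at_right 0) F \<Longrightarrow> (w \<longlongrightarrow> w0) F \<Longrightarrow>
       ((\<lambda>t. f (u t * poly R (u t powr (1 / real D)) + w t * u t powr \<xi>, u t) / u t powr m)
          \<longlongrightarrow> poly Q w0) F"
proof -
  from f(1) obtain c r where r: "0 < r" and c: "\<And>x y. \<bar>x\<bar> < r \<Longrightarrow> \<bar>y\<bar> < r \<Longrightarrow>
        ((\<lambda>(i, j). c (i, j) * x ^ i * y ^ j) has_sum f (x, y)) UNIV"
    unfolding analytic_germ_def by blast
  have "\<exists>j i. c (i, j) \<noteq> 0"
  proof (rule ccontr)
    assume "\<not> (\<exists>j i. c (i, j) \<noteq> 0)"
    then have c0: "(\<lambda>(i, j). c (i, j) * x ^ i * y ^ j) = (\<lambda>_. 0)" for x y by auto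
    have "f (x, y) = 0" if "\<bar>x\<bar> < r" "\<bar>y\<bar> < r" for x y
      using c[OF that] unfolding c0 by (metis has_sum_0 infsumI)
    then have "\<forall>\<^sub>F p in nhds 0. f p = 0"
      unfolding eventually_nhds_metric using r
      by (auto simp: dist_norm intro!: exI[of _ r])
        (metis fst_conv norm_fst_le norm_snd_le order.strict_trans1 real_norm_def snd_conv)
    with f(2) show False by blast
  qed
  then obtain k0 where k0: "\<exists>i. c (i, k0) \<noteq> 0" "\<And>i j. j < k0 \<Longrightarrow> c (i, j) = 0"
    using exists_least_iff[of "\<lambda>j. \<exists>i. c (i, j) \<noteq> 0"] by blast
  then obtain p0 where p0: "c (p0, k0) \<noteq> 0" by blast
  \<comment> \<open>The shifted polynomial depends on \<open>K\<close>, so \<open>K\<close> is fixed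
    from \<open>p0\<close> and \<open>k0\<close> alone, whose monomial will have weight
    \<open>p0 * \<xi> + k0\<close>.\<close>
  obtain K where K: "real p0 * \<xi> + real k0 \<le> real K" using real_arch_simple by blast
  have "real p0 \<le> real p0 * \<xi>" using \<open>1 < \<xi>\<close> by (simp add: mult_le_cancel_left1)
  moreover have "0 \<le> real p0 * \<xi>" using \<open>1 < \<xi>\<close> by simp
  ultimately have "real p0 \<le> real K" "real k0 \<le> real K" using K by linarith+
  then have pK: "p0 \<le> K" "k0 \<le> K" by simp_all
  obtain C where C: "\<And>x y \<rho>. \<bar>x\<bar> \<le> \<rho> \<Longrightarrow> \<bar>y\<bar> \<le> \<rho> \<Longrightarrow> \<rho> \<le> r / 2 \<Longrightarrow>
     \<bar>f (x, y) - (\<Sum>(i, j)\<in>{..K} \<times> {..K}. c (i, j) * x ^ i * y ^ j)\<bar> \<le> C * \<rho> ^ Suc K"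
    using double_series_remainder[of r c f K, OF r c] by blast
  define G where "G i k = coeff (coeff (shifted_poly c D R K) i) k" for i k
  note ex = poly_poly_eq_sum[of "shifted_poly c D R K", folded G_def]
  obtain B where B: "finite B" "\<And>i k. (i, k) \<in> B \<longleftrightarrow> G i k \<noteq> 0"
    and GB: "\<And>X s. poly (poly (shifted_poly c D R K) [:X:]) s = (\<Sum>(i, k)\<in>B. G i k * X ^ i * s ^ k)"
    by (rule ex, rule that)
  define e where "e = (\<lambda>(i, k). real i * \<xi> + real k / real D)"
  define m where "m = Min (e ` B)"
  \<comment> \<open>This monomial has weight at most \<open>K\<close>, hence is not lost in the remainder.\<close>
  have "(p0, D * k0) \<in> B"
    unfolding B G_def using coeff_shifted_poly[of k0 c, OF k0(2) pK \<open>0 < D\<close>] p0 by simp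
  then have "m \<le> e (p0, D * k0)" and mB: "m \<in> e ` B"
    unfolding m_def using B(1) by (auto intro!: Min_le Min_in)
  then have mK: "m < real (Suc K)" using K \<open>0 < D\<close> by (simp add: e_def)
  have me: "m \<le> e ik" if "ik \<in> B" for ik unfolding m_def using B(1) that by simp
  define Q where "Q = (\<Sum>(i, k)\<in>{ik\<in>B. e ik = m}. monom (G i k) i)"
  \<comment> \<open>For given \<open>i\<close> the weight determines \<open>k\<close>, so each
    coefficient of \<open>Q\<close> comes from at most one monomial and no cancellation
    occurs.\<close>
  have inj: "k = k'" if "e (i, k) = e (i, k')" for i k k'
    using that \<open>0 < D\<close> by (simp add: e_def)
  have coeffQ: "coeff Q i = (\<Sum>ik\<in>{ik\<in>B. e ik = m \<and> fst ik = i}. G i (snd ik))" for i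
    unfolding Q_def coeff_sum using B(1) by (intro sum.mono_neutral_cong_right) (auto split: if_splits)
  have coeffQ_nz: "coeff Q i \<noteq> 0" if ik: "(i, k) \<in> B" "e (i, k) = m" for i k
  proof -
    have "{ik\<in>B. e ik = m \<and> fst ik = i} = {(i, k)}" using ik inj by fastforce
    then show ?thesis using ik B(2) unfolding coeffQ by auto
  qed
  have coeffQ_ex: "\<exists>k. e (i, k) = m" if "coeff Q i \<noteq> 0" for i
  proof -
    have "{ik\<in>B. e ik = m \<and> fst ik = i} \<noteq> {}" using that unfolding coeffQ by (metis sum.empty)
    then show ?thesis by auto
  qed
  obtain i k where "(i, k) \<in> B" "e (i, k) = m" using mB by (metis imageE prod.collapse)
  then have "Q \<noteq> 0" using coeffQ_nz by fastforce
  moreover have "coeff Q i = 0" if nz: "coeff Q (Suc i) \<noteq> 0" for i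
  proof (rule ccontr)
    assume "coeff Q i \<noteq> 0"
    then obtain k k' where "e (i, k) = m" "e (Suc i, k') = m" using coeffQ_ex nz by blast
    \<comment> \<open>Equal weights of \<open>X ^ i * s ^ k\<close> and
      \<open>X ^ Suc i * s ^ k'\<close> would make D \<xi> an integer.\<close>
    then have "real D * \<xi> = of_int (int k - int k')" using \<open>0 < D\<close> by (simp add: e_def field_simps)
    then show False using assms(5) by (metis Ints_of_int)
  qed
  moreover have "((\<lambda>t. f (u t * poly R (u t powr (1 / real D)) + w t * u t powr \<xi>, u t) / u t powr m)
          \<longlongrightarrow> poly Q w0) F"
    if u: "filterlim u (at_right 0) F" and w: "(w \<longlongrightarrow> w0) F"
    for F :: "'b filter" and u w w0
  proof -
    let ?s = "\<lambda>t. u t powr (1 / real D)"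
    let ?x = "\<lambda>t. u t * poly R (?s t) + w t * u t powr \<xi>"
    let ?T = "\<lambda>t. \<Sum>(i, j)\<in>{..K} \<times> {..K}. c (i, j) * ?x t ^ i * u t ^ j"
    note powr0 = tendsto_powr_at_right_0[OF u]
    have u0: "(u \<longlongrightarrow> 0) F" and upos: "\<forall>\<^sub>F t in F. 0 < u t"
      using u by (auto simp: filterlim_at elim: eventually_mono)
    have main: "((\<lambda>t. \<Sum>ik\<in>B. G (fst ik) (snd ik) * w t ^ fst ik * u t powr (e ik - m))
        \<longlongrightarrow> (\<Sum>ik\<in>B. G (fst ik) (snd ik) * w0 ^ fst ik * (if e ik = m then 1 else 0))) F"
    proof (intro tendsto_sum tendsto_mult tendsto_const tendsto_power w)
      fix ik assume "ik \<in> B"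
      then show "((\<lambda>t. u t powr (e ik - m)) \<longlongrightarrow> (if e ik = m then 1 else 0)) F"
        using me[of ik] powr0[of "e ik - m"] upos
        by (cases "e ik = m") (auto intro!: tendsto_eventually elim: eventually_mono)
    qed
    have "(\<Sum>ik\<in>B. G (fst ik) (snd ik) * w0 ^ fst ik * (if e ik = m then 1 else 0)) = poly Q w0"
      unfolding Q_def poly_sum using B(1)
      by (intro sum.mono_neutral_cong_right) (auto simp: poly_monom split: if_splits)
    with main have main: "((\<lambda>t. \<Sum>ik\<in>B. G (fst ik) (snd ik) * w t ^ fst ik * u t powr (e ik - m))
        \<longlongrightarrow> poly Q w0) F" by simp
    have "\<forall>\<^sub>F t in F. (\<Sum>ik\<in>B. G (fst ik) (snd ik) * w t ^ fst ik * u t powr (e ik - m)) = ?T t / u t powr m"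
      using upos
    proof eventually_elim
      case (elim t)
      have sD: "?s t ^ D = u t" using elim \<open>0 < D\<close> by (simp add: powr_power)
      have "?T t = poly (poly (shifted_poly c D R K) [:w t * u t powr \<xi>:]) (?s t)"
        unfolding poly_shifted_poly sD ..
      also have "\<dots> = (\<Sum>ik\<in>B. G (fst ik) (snd ik) * (w t * u t powr \<xi>) ^ fst ik * ?s t ^ snd ik)"
        unfolding GB by (simp add: case_prod_beta)
      also have "\<dots> = (\<Sum>ik\<in>B. G (fst ik) (snd ik) * w t ^ fst ik * u t powr e ik)"
        using elim by (intro sum.cong)
          (auto simp: e_def powr_add powr_power power_mult_distrib mult_ac)
      finally show ?case using elim by (simp add: sum_divide_distrib powr_diff)
    qed
    with main have T: "((\<lambda>t. ?T t / u t powr m) \<longlongrightarrow> poly Q w0) F"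
      by (rule Lim_transform_eventually)
    have "((\<lambda>t. (f (?x t, u t) - ?T t) / u t powr m) \<longlongrightarrow> 0) F"
    proof (rule Lim_null_comparison)
      \<comment> \<open>\<open>M\<close> bounds |x| / u, which tends to |R(0)| because \<xi> > 1;
        the summand 1 gives room for this limit and also M \<ge> 1, so that |u| \<le> M u.\<close>
      define M where "M = \<bar>poly R 0\<bar> + 1"
      have "((\<lambda>t. poly R (?s t) + w t * u t powr (\<xi> - 1)) \<longlongrightarrow> poly R 0 + w0 * 0) F"
        using \<open>0 < D\<close> \<open>1 < \<xi>\<close> by (intro tendsto_intros tendsto_poly powr0 w) auto
      then have "\<forall>\<^sub>F t in F. \<bar>poly R (?s t) + w t * u t powr (\<xi> - 1)\<bar> < M"
        using tendsto_rabs order_tendstoD(2)[of "\<lambda>t. \<bar>poly R (?s t) + w t * u t powr (\<xi> - 1)\<bar>" _ F M]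
        by (fastforce simp: M_def)
      moreover have "((\<lambda>t. M * u t) \<longlongrightarrow> M * 0) F" by (intro tendsto_intros u0)
      then have "\<forall>\<^sub>F t in F. M * u t < r / 2" using r by (intro order_tendstoD(2)[of _ "M * 0"]) auto
      ultimately show "\<forall>\<^sub>F t in F. norm ((f (?x t, u t) - ?T t) / u t powr m)
          \<le> C * M ^ Suc K * u t powr (real (Suc K) - m)"
        using upos
      proof eventually_elim
        case (elim t)
        have "?x t = u t * (poly R (?s t) + w t * u t powr (\<xi> - 1))"
          using elim by (simp add: powr_diff algebra_simps)
        then have "\<bar>?x t\<bar> \<le> M * u t"
          using elim by (simp add: abs_mult mult.commute)
        moreover have "\<bar>u t\<bar> \<le> M * u t" using elim by (simp add: M_def)
        ultimately have "\<bar>f (?x t, u t) - ?T t\<bar> \<le> C * (M * u t) ^ Suc K"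
          using elim by (intro C) auto
        also have "\<dots> = C * M ^ Suc K * u t powr (real (Suc K) - m) * u t powr m"
          using elim by (simp add: powr_add[symmetric] powr_realpow[symmetric] power_mult_distrib mult_ac del: power_Suc of_nat_Suc)
        finally show ?case using elim by (simp add: divide_le_eq)
      qed
      show "((\<lambda>t. C * M ^ Suc K * u t powr (real (Suc K) - m)) \<longlongrightarrow> 0) F"
        using mK by (intro tendsto_mult_right_zero powr0) simp
    qed
    from tendsto_add[OF this T] show ?thesis by (simp add: add_divide_distrib[symmetric])
  qed
  ultimately show thesis by (rule that)
qed

subsection \<open>Images of neighbouring arcs\<close>

lemma tendsto_0_of_quotient:
  fixes h :: "real \<Rightarrow> real"
  assumes "((\<lambda>y. h y / y) \<longlongrightarrow> k) (at_right 0)"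
  shows "(h \<longlongrightarrow> 0) (at_right 0)"
proof -
  have "((\<lambda>y. h y / y * y) \<longlongrightarrow> k * 0) (at_right 0)"
    by (intro tendsto_mult assms) (auto intro: tendsto_eq_intros)
  moreover have "\<forall>\<^sub>F y in at_right 0. h y / y * y = h y"
    using eventually_at_right_less[of "0::real"] by eventually_elim simp
  ultimately show ?thesis by (auto elim: Lim_transform_eventually)
qed

lemma fractional_expansion_slope:
  fixes l :: "real \<Rightarrow> real" and R :: "real poly"
  assumes "0 < D" "1 < \<xi>"
    and l: "((\<lambda>y. (l y - y * poly R (y powr (1 / real D))) / y powr \<xi>) \<longlongrightarrow> A) (at_right 0)"
  shows "((\<lambda>y. l y / y) \<longlongrightarrow> poly R 0) (at_right 0)"
proof -
  have pos: "\<forall>\<^sub>F y in at_right (0::real). 0 < y" by (rule eventually_at_right_less)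
  note powr0 = tendsto_powr_at_right_0[OF filterlim_ident]
  have "((\<lambda>y. poly R (y powr (1 / real D))
      + (l y - y * poly R (y powr (1 / real D))) / y powr \<xi> * y powr (\<xi> - 1)) \<longlongrightarrow> poly R 0 + A * 0) (at_right 0)"
    using assms by (intro tendsto_intros tendsto_poly powr0 l) auto
  moreover have "\<forall>\<^sub>F y in at_right 0. poly R (y powr (1 / real D))
      + (l y - y * poly R (y powr (1 / real D))) / y powr \<xi> * y powr (\<xi> - 1) = l y / y"
    using pos by eventually_elim (simp add: powr_diff field_simps)
  ultimately show ?thesis by (auto elim: Lim_transform_eventually)
qed

text \<open>The image of the arc with parameter \<open>z\<close> differs from that of the arc z = 0
  by \<open>z * y powr \<xi>\<close> times \<open>L (1, 0)\<close>, up to smaller order. Its second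
  coordinate moves too, which shifts the truncation of \<open>l'\<close> at slope
  \<open>poly R' 0\<close>. What remains is linear in \<open>z\<close>; rescaling from
  \<open>y\<close> to the new second coordinate divides by \<open>c powr \<xi>\<close>.\<close>

lemma image_of_neighbouring_arcs:
  fixes \<sigma> L :: "real \<times> real \<Rightarrow> real \<times> real" and l l' :: "real \<Rightarrow> real" and R R' :: "real poly"
  assumes \<sigma>: "strict_derivative_at_0 \<sigma> L UNIV" "\<sigma> 0 = 0" "isCont \<sigma> 0" and inj: "inj L"
    and D: "0 < D" and \<xi>: "1 < \<xi>"
    and l: "((\<lambda>y. (l y - y * poly R (y powr (1 / real D))) / y powr \<xi>) \<longlongrightarrow> A) (at_right 0)"
    and l': "((\<lambda>y. (l' y - y * poly R' (y powr (1 / real D))) / y powr \<xi>) \<longlongrightarrow> B) (at_right 0)"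
    and "l' 0 = 0" and im: "\<forall>\<^sub>F y in at_right 0. \<exists>v\<ge>0. \<sigma> (l y, y) = (l' v, v)"
  obtains c p where "0 < c" "p \<noteq> 0"
    "\<And>z. ((\<lambda>y. snd (\<sigma> (l y + z * y powr \<xi>, y)) / y) \<longlongrightarrow> c) (at_right 0)"
    "\<And>z. filterlim (\<lambda>y. snd (\<sigma> (l y + z * y powr \<xi>, y))) (at_right 0) (at_right 0)"
    "\<And>z. ((\<lambda>y. (fst (\<sigma> (l y + z * y powr \<xi>, y))
        - snd (\<sigma> (l y + z * y powr \<xi>, y)) * poly R' (snd (\<sigma> (l y + z * y powr \<xi>, y)) powr (1 / real D)))
        / snd (\<sigma> (l y + z * y powr \<xi>, y)) powr \<xi>) \<longlongrightarrow> B + p * z) (at_right 0)"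
proof -
  interpret L: bounded_linear L using \<sigma>(1) unfolding strict_derivative_at_0_def by blast
  define \<phi> where "\<phi> = (\<lambda>v. v * poly R' (v powr (1 / real D)))"
  have l': "((\<lambda>y. (l' y - \<phi> y) / y powr \<xi>) \<longlongrightarrow> B) (at_right 0)"
    using l' by (simp add: \<phi>_def)
  have pos: "\<forall>\<^sub>F y in at_right (0::real). 0 < y" by (rule eventually_at_right_less)
  have id0: "((\<lambda>y::real. y) \<longlongrightarrow> 0) (at_right 0)" by (auto intro: tendsto_eq_intros)
  note powr0 = tendsto_powr_at_right_0[OF filterlim_ident]
  have slope: "((\<lambda>y. l y / y) \<longlongrightarrow> poly R 0) (at_right 0)"
    by (rule fractional_expansion_slope[OF D \<xi> l])
  have slope': "((\<lambda>y. l' y / y) \<longlongrightarrow> poly R' 0) (at_right 0)"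
    using fractional_expansion_slope[OF D \<xi>, of l' R'] l' unfolding \<phi>_def by blast
  have l0: "(l \<longlongrightarrow> 0) (at_right 0)" by (rule tendsto_0_of_quotient[OF slope])
  define P where "P y = (l y, y)" for y
  define v where "v y = snd (\<sigma> (P y))" for y
  \<comment> \<open>The second component of the image under \<open>L\<close> of the tangent vector
    of the first arc.\<close>
  define c where "c = snd (L (poly R 0, 1))"
  have P0: "(P \<longlongrightarrow> 0) (at_right 0)"
    unfolding P_def zero_prod_def by (intro tendsto_Pair l0 id0)
  have "((\<lambda>y. (l y / y, y / y)) \<longlongrightarrow> (poly R 0, 1)) (at_right 0)"
    using pos by (intro tendsto_Pair slope tendsto_eventually) (auto elim: eventually_mono)
  then have "((\<lambda>y. (P y - 0) /\<^sub>R y) \<longlongrightarrow> (poly R 0, 1)) (at_right 0)"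
    by (simp only: P_def diff_zero scaleR_Pair real_scaleR_def divide_inverse mult.commute)
  from strict_derivative_tendsto[OF \<sigma>(1) P0 _ tendsto_const _ pos this]
  have \<sigma>P: "((\<lambda>y. \<sigma> (P y) /\<^sub>R y) \<longlongrightarrow> L (poly R 0, 1)) (at_right 0)" by (simp add: \<sigma>(2))
  have vy: "((\<lambda>y. v y / y) \<longlongrightarrow> c) (at_right 0)"
    using tendsto_snd[OF \<sigma>P] by (simp add: v_def c_def divide_inverse mult.commute)
  have fy: "((\<lambda>y. fst (\<sigma> (P y)) / y) \<longlongrightarrow> fst (L (poly R 0, 1))) (at_right 0)"
    using tendsto_fst[OF \<sigma>P] by (simp add: divide_inverse mult.commute)
  have im: "\<forall>\<^sub>F y in at_right 0. 0 \<le> v y \<and> \<sigma> (P y) = (l' (v y), v y)"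
    using im by eventually_elim (auto simp: P_def v_def)
  have v0: "(v \<longlongrightarrow> 0) (at_right 0)" by (rule tendsto_0_of_quotient[OF vy])
  have Lnz: "L w \<noteq> 0" if "w \<noteq> 0" for w using inj that L.zero by (metis injD)
  have "0 \<le> c"
  proof (rule tendsto_lowerbound[OF vy])
    show "\<forall>\<^sub>F y in at_right 0. 0 \<le> v y / y" using im pos by eventually_elim simp
  qed simp
  moreover have "c \<noteq> 0"
  proof
    \<comment> \<open>Then v = o(y), and since \<open>l'\<close> is bounded by a multiple of its
      argument, the first coordinate is o(y) as well. So \<open>L\<close> would kill the tangent
      vector. As only v \<ge> 0 is known yet, \<open>l' 0 = 0\<close> handles v = 0.\<close>
    assume "c = 0"
    have "\<forall>\<^sub>F y in at_right 0. \<bar>l' y / y\<bar> < \<bar>poly R' 0\<bar> + 1"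
      using tendsto_rabs[OF slope'] by (rule order_tendstoD) simp
    then obtain d where d: "0 < d" "\<And>y. 0 < y \<Longrightarrow> y < d \<Longrightarrow> \<bar>l' y / y\<bar> < \<bar>poly R' 0\<bar> + 1"
      by (auto simp: eventually_at_right_field)
    have bd: "\<bar>l' y\<bar> \<le> (\<bar>poly R' 0\<bar> + 1) * y" if "0 \<le> y" "y < d" for y
      using d(2)[of y] that \<open>l' 0 = 0\<close> by (cases "y = 0") (auto simp: field_simps)
    have "((\<lambda>y. fst (\<sigma> (P y)) / y) \<longlongrightarrow> 0) (at_right 0)"
    proof (rule Lim_null_comparison)
      show "((\<lambda>y. (\<bar>poly R' 0\<bar> + 1) * (v y / y)) \<longlongrightarrow> 0) (at_right 0)"
        using vy \<open>c = 0\<close> by (intro tendsto_mult_right_zero) simp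
      have "\<forall>\<^sub>F y in at_right 0. v y < d" using v0 d(1) by (rule order_tendstoD)
      then show "\<forall>\<^sub>F y in at_right 0. norm (fst (\<sigma> (P y)) / y) \<le> (\<bar>poly R' 0\<bar> + 1) * (v y / y)"
        using im pos
      proof eventually_elim
        case (elim y)
        then have "\<bar>l' (v y)\<bar> \<le> (\<bar>poly R' 0\<bar> + 1) * v y" using bd by blast
        then show ?case using elim by (simp add: divide_right_mono)
      qed
    qed
    then have "fst (L (poly R 0, 1)) = 0" using fy by (intro tendsto_unique[OF _ fy]) auto
    then have "L (poly R 0, 1) = 0" using \<open>c = 0\<close> by (simp add: c_def prod_eq_iff)
    then show False using Lnz[of "(poly R 0, 1)"] by (simp add: zero_prod_def)
  qed
  ultimately have c: "0 < c" by simp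
  have vpos: "\<forall>\<^sub>F y in at_right 0. 0 < v y"
    using order_tendstoD(1)[OF vy c] pos by eventually_elim (simp add: zero_less_divide_iff)
  then have vr: "filterlim v (at_right 0) (at_right 0)"
    using v0 by (auto simp: filterlim_at elim: eventually_mono)
  have l'v: "((\<lambda>y. (l' (v y) - \<phi> (v y)) / v y powr \<xi>) \<longlongrightarrow> B) (at_right 0)"
    by (rule filterlim_compose[OF l' vr])
  \<comment> \<open>The limit of the first coordinate over \<open>y\<close> computed a second way,
    through \<open>l'\<close>: hence \<open>L\<close> maps tangent to tangent.\<close>
  have "((\<lambda>y. l' (v y) / v y * (v y / y)) \<longlongrightarrow> poly R' 0 * c) (at_right 0)"
    by (intro tendsto_mult vy filterlim_compose[OF slope' vr])
  moreover have "\<forall>\<^sub>F y in at_right 0. l' (v y) / v y * (v y / y) = fst (\<sigma> (P y)) / y"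
    using im vpos by eventually_elim simp
  ultimately have "((\<lambda>y. fst (\<sigma> (P y)) / y) \<longlongrightarrow> poly R' 0 * c) (at_right 0)"
    by (rule Lim_transform_eventually)
  then have "fst (L (poly R 0, 1)) = poly R' 0 * c" using fy by (intro tendsto_unique[OF _ fy]) auto
  then have L1: "L (poly R 0, 1) = c *\<^sub>R (poly R' 0, 1)" by (simp add: c_def prod_eq_iff)
  \<comment> \<open>The component of \<open>L (1, 0)\<close> transverse to the tangent
    \<open>(poly R' 0, 1)\<close> of the second arc. If it vanished, \<open>L\<close> would map (1,
    0) and the tangent of the first arc to parallel vectors.\<close>
  define q where "q = fst (L (1, 0)) - poly R' 0 * snd (L (1, 0))"
  have "q \<noteq> 0"
  proof
    assume "q = 0"
    then have "L (1, 0) = snd (L (1, 0)) *\<^sub>R (poly R' 0, 1)" by (simp add: q_def prod_eq_iff)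
    moreover have "(poly R' 0, 1) = (1 / c) *\<^sub>R L (poly R 0, 1)" using c L1 by simp
    ultimately have "L (1, 0) = L ((snd (L (1, 0)) / c) *\<^sub>R (poly R 0, 1))"
      by (metis (no_types, lifting) L.scaleR scaleR_scaleR times_divide_eq_right mult.right_neutral)
    then have "(1, 0) = (snd (L (1, 0)) / c) *\<^sub>R (poly R 0, 1 :: real)" using inj by (simp only: inj_eq)
    then show False by (auto simp: prod_eq_iff)
  qed
  define p where "p = q / c powr \<xi>"
  have "p \<noteq> 0" using \<open>q \<noteq> 0\<close> c by (simp add: p_def)
  have powr_pos: "\<forall>\<^sub>F y in at_right 0. 0 < y powr \<xi>" using pos by eventually_elim simp
  define S where "S z y = \<sigma> (l y + z * y powr \<xi>, y)" for z y
  have Sdiff: "((\<lambda>y. (S z y - \<sigma> (P y)) /\<^sub>R y powr \<xi>) \<longlongrightarrow> z *\<^sub>R L (1, 0)) (at_right 0)" for z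
  proof -
    have "((\<lambda>y. (l y + z * y powr \<xi>, y)) \<longlongrightarrow> (0 + z * 0, 0)) (at_right 0)"
      using \<xi> by (intro tendsto_Pair tendsto_add tendsto_mult tendsto_const l0 powr0 id0) simp
    then have P': "((\<lambda>y. (l y + z * y powr \<xi>, y)) \<longlongrightarrow> 0) (at_right 0)" by (simp add: zero_prod_def)
    have "\<forall>\<^sub>F y in at_right 0. ((l y + z * y powr \<xi>, y) - P y) /\<^sub>R y powr \<xi> = z *\<^sub>R (1, 0)"
      using pos by eventually_elim (simp add: P_def)
    then have "((\<lambda>y. ((l y + z * y powr \<xi>, y) - P y) /\<^sub>R y powr \<xi>) \<longlongrightarrow> z *\<^sub>R (1, 0)) (at_right 0)"
      by (rule tendsto_eventually)
    from strict_derivative_tendsto[OF \<sigma>(1) P' _ P0 _ powr_pos this] show ?thesis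
      unfolding S_def L.scaleR by simp
  qed
  have S1: "((\<lambda>y. (fst (S z y) - fst (\<sigma> (P y))) / y powr \<xi>) \<longlongrightarrow> z * fst (L (1, 0))) (at_right 0)" for z
    using tendsto_fst[OF Sdiff[of z]] by (simp add: divide_inverse mult.commute)
  have S2: "((\<lambda>y. (snd (S z y) - v y) / y powr \<xi>) \<longlongrightarrow> z * snd (L (1, 0))) (at_right 0)" for z
    using tendsto_snd[OF Sdiff[of z]] by (simp add: v_def divide_inverse mult.commute)
  have Sy: "((\<lambda>y. snd (S z y) / y) \<longlongrightarrow> c) (at_right 0)" for z
  proof -
    have "((\<lambda>y. (snd (S z y) - v y) / y powr \<xi> * y powr (\<xi> - 1) + v y / y)
        \<longlongrightarrow> z * snd (L (1, 0)) * 0 + c) (at_right 0)"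
      using \<xi> by (intro tendsto_add tendsto_mult S2 powr0 vy) simp
    moreover have "\<forall>\<^sub>F y in at_right 0. (snd (S z y) - v y) / y powr \<xi> * y powr (\<xi> - 1) + v y / y
        = snd (S z y) / y"
      using pos by eventually_elim (simp add: powr_diff field_simps)
    ultimately show ?thesis by (auto elim: Lim_transform_eventually)
  qed
  have Spos: "\<forall>\<^sub>F y in at_right 0. 0 < snd (S z y)" for z
    using order_tendstoD(1)[OF Sy[of z] c] pos by eventually_elim (simp add: zero_less_divide_iff)
  have S0: "((\<lambda>y. snd (S z y)) \<longlongrightarrow> 0) (at_right 0)" for z
    by (rule tendsto_0_of_quotient[OF Sy])
  have Sr: "filterlim (\<lambda>y. snd (S z y)) (at_right 0) (at_right 0)" for z
    using S0[of z] Spos[of z] by (auto simp: filterlim_at elim: eventually_mono)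
  \<comment> \<open>Strict differentiability again, now of the truncation between two positive
    second coordinates.\<close>
  have S\<phi>: "((\<lambda>y. (\<phi> (snd (S z y)) - \<phi> (v y)) / y powr \<xi>)
      \<longlongrightarrow> z * snd (L (1, 0)) * poly R' 0) (at_right 0)" for z
  proof -
    have "((\<lambda>y. (snd (S z y) - v y) /\<^sub>R y powr \<xi>) \<longlongrightarrow> z * snd (L (1, 0))) (at_right 0)"
      using S2[of z] by (simp add: divide_inverse mult.commute)
    from strict_derivative_tendsto[OF fractional_poly_strict_derivative[OF D, of R'] S0 _ v0 _ powr_pos this]
    show ?thesis
      using Spos[of z] vpos unfolding \<phi>_def by (simp add: divide_inverse mult.commute)
  qed
  have "((\<lambda>y. (fst (S z y) - \<phi> (snd (S z y))) / snd (S z y) powr \<xi>) \<longlongrightarrow> B + p * z) (at_right 0)" for z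
  proof -
    \<comment> \<open>Telescopes through the first coordinate of \<sigma>(P y), which equals
      \<open>l' (v y)\<close>.\<close>
    have "((\<lambda>y. ((fst (S z y) - fst (\<sigma> (P y))) / y powr \<xi>
          + (l' (v y) - \<phi> (v y)) / v y powr \<xi> * (v y / y) powr \<xi>
          - (\<phi> (snd (S z y)) - \<phi> (v y)) / y powr \<xi>) / (snd (S z y) / y) powr \<xi>)
        \<longlongrightarrow> (z * fst (L (1, 0)) + B * c powr \<xi> - z * snd (L (1, 0)) * poly R' 0) / c powr \<xi>) (at_right 0)"
      using c by (intro tendsto_divide tendsto_diff tendsto_add tendsto_mult S1 S\<phi> tendsto_powr vy Sy
          tendsto_const l'v) auto
    moreover have "(z * fst (L (1, 0)) + B * c powr \<xi> - z * snd (L (1, 0)) * poly R' 0) / c powr \<xi> = B + p * z"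
      using c by (simp add: p_def q_def field_simps)
    moreover have "\<forall>\<^sub>F y in at_right 0. ((fst (S z y) - fst (\<sigma> (P y))) / y powr \<xi>
          + (l' (v y) - \<phi> (v y)) / v y powr \<xi> * (v y / y) powr \<xi>
          - (\<phi> (snd (S z y)) - \<phi> (v y)) / y powr \<xi>) / (snd (S z y) / y) powr \<xi>
        = (fst (S z y) - \<phi> (snd (S z y))) / snd (S z y) powr \<xi>"
      using pos vpos Spos[of z] im
      by eventually_elim (simp add: powr_divide field_simps)
    ultimately show ?thesis by (auto elim: Lim_transform_eventually)
  qed
  with c \<open>p \<noteq> 0\<close> Sy Sr show thesis
    unfolding S_def \<phi>_def by (rule that)
qed

subsection \<open>Coefficients of corresponding roots\<close>

lemma order_unique_at_right_0:
  fixes h :: "real \<Rightarrow> real"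
  assumes A: "((\<lambda>y. h y / y powr m) \<longlongrightarrow> A) (at_right 0)" "A \<noteq> 0"
    and B: "((\<lambda>y. h y / y powr n) \<longlongrightarrow> B) (at_right 0)" "B \<noteq> 0"
  shows "m = n"
proof -
  have "\<not> k < n'" if C: "((\<lambda>y. h y / y powr k) \<longlongrightarrow> C) (at_right 0)" "C \<noteq> 0"
    and E: "((\<lambda>y. h y / y powr n') \<longlongrightarrow> E) (at_right 0)" for k n' C E
  proof
    assume "k < n'"
    have "((\<lambda>y::real. y powr (n' - k)) \<longlongrightarrow> 0) (at_right 0)"
      using \<open>k < n'\<close> by (intro tendsto_powr_at_right_0 filterlim_ident) simp
    with E have "((\<lambda>y. h y / y powr n' * y powr (n' - k)) \<longlongrightarrow> E * 0) (at_right 0)"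
      by (intro tendsto_mult)
    moreover have "\<forall>\<^sub>F y in at_right 0. h y / y powr n' * y powr (n' - k) = h y / y powr k"
      using eventually_at_right_less[of "0::real"] by eventually_elim (simp add: powr_diff)
    ultimately have "((\<lambda>y. h y / y powr k) \<longlongrightarrow> 0) (at_right 0)"
      by (auto elim: Lim_transform_eventually)
    then show False using C by (meson tendsto_unique trivial_limit_at_right_real)
  qed
  from this[OF A B(1)] this[OF B A(1)] show ?thesis by simp
qed

text \<open>Injectivity comes from the chain rule: the derivative of the local inverse is a left
  inverse of \<open>L\<close>.\<close>

lemma C1_diffeo_germ_strict_derivative:
  assumes "C1_diffeo_germ U V \<sigma>"
  obtains L where "strict_derivative_at_0 \<sigma> L UNIV" "inj L" "isCont \<sigma> 0"
proof -
  let ?\<tau> = "inv_into U \<sigma>"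
  from assms have U: "0 \<in> U" "\<sigma> 0 = 0" "open U" "open V" "bij_betw \<sigma> U V" "C1_on U \<sigma>" "C1_on V ?\<tau>"
    unfolding C1_diffeo_germ_def C1_diffeomorphism_def by blast+
  obtain L where L: "(\<sigma> has_derivative L) (at 0)" "strict_derivative_at_0 \<sigma> L UNIV"
    using C1_on_strict_derivative[OF U(3,1,6)] .
  have "0 \<in> V" using U bij_betwE by metis
  then obtain M where M: "(?\<tau> has_derivative M) (at 0)"
    using C1_on_strict_derivative[OF U(4) _ U(7)] by blast
  have "((?\<tau> \<circ> \<sigma>) has_derivative (M \<circ> L)) (at 0)"
    using diff_chain_at[OF L(1)] M U(2) by simp
  moreover have "\<And>p. p \<in> U \<Longrightarrow> (?\<tau> \<circ> \<sigma>) p = id p"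
    using U(5) by (simp add: bij_betw_inv_into_left)
  ultimately have "(id has_derivative (M \<circ> L)) (at 0)"
    using has_derivative_transform_within_open[OF _ U(3,1)] by blast
  moreover have "(id has_derivative (\<lambda>p. p)) (at 0)" by (simp add: id_def)
  ultimately have "M \<circ> L = (\<lambda>p. p)" by (rule has_derivative_unique)
  then have "inj L" by (metis comp_apply injI)
  with L show thesis using has_derivative_continuous by (intro that) auto
qed

lemma puiseux_value_0: "puiseux_value a 0 = 0"
  by (simp add: puiseux_value_def)

text \<open>Germ relations hold only near the origin; this reads them along a path tending to
  it.\<close>

lemma newton_puiseux_root_eventually:
  assumes "newton_puiseux_root f a \<gamma>" "(w \<longlongrightarrow> 0) F"
  shows "\<forall>\<^sub>F t in F. w t \<in> \<gamma> \<longleftrightarrow> 0 \<le> snd (w t) \<and> fst (w t) = puiseux_value a (snd (w t))"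
    and "\<forall>\<^sub>F t in F. w t \<in> \<gamma> \<longrightarrow> f (w t) = 0"
proof -
  have "\<forall>\<^sub>F t in F. w t \<in> \<gamma> \<longleftrightarrow> w t \<in> {(puiseux_value a y, y) | y. 0 \<le> y}"
    using assms eventually_compose_filterlim unfolding newton_puiseux_root_def set_germ_eq_def by blast
  then show "\<forall>\<^sub>F t in F. w t \<in> \<gamma> \<longleftrightarrow> 0 \<le> snd (w t) \<and> fst (w t) = puiseux_value a (snd (w t))"
    by eventually_elim (auto simp: prod_eq_iff)
  have "\<forall>\<^sub>F t in F. w t \<in> \<gamma> \<longrightarrow> w t \<in> f -` {0}"
    using assms eventually_compose_filterlim unfolding newton_puiseux_root_def set_germ_subset_def by blast
  then show "\<forall>\<^sub>F t in F. w t \<in> \<gamma> \<longrightarrow> f (w t) = 0" by eventually_elim simp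
qed

text \<open>The function \<open>f\<close> on the arcs \<open>P z\<close> has a leading term given by
  \<open>Q\<close>, and through f = g \<circ> \<sigma> also one given by \<open>Q'\<close>.
  Comparing them for all \<open>z\<close> makes the two polynomials affinely conjugate.\<close>

lemma puiseux_coeff_eq_0_iff:
  fixes f g :: "real \<times> real \<Rightarrow> real" and \<xi> :: rat
  assumes \<sigma>: "C1_diffeo_germ U V \<sigma>"
    and f: "analytic_germ f" "\<not> (\<forall>\<^sub>F p in nhds 0. f p = 0)"
    and g: "analytic_germ g" "\<not> (\<forall>\<^sub>F p in nhds 0. g p = 0)"
    and fg: "\<forall>\<^sub>F p in nhds 0. f p = g (\<sigma> p)"
    and \<gamma>: "newton_puiseux_root f a \<gamma>" and \<gamma>': "newton_puiseux_root g b \<gamma>'"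
    and img: "set_germ_eq (\<sigma> ` (\<gamma> \<inter> U)) \<gamma>'"
    and D: "0 < D" "of_nat D * \<xi> \<notin> \<int>"
    and a: "\<And>\<alpha>. a \<alpha> \<noteq> 0 \<Longrightarrow> \<alpha> < \<xi> \<Longrightarrow> of_nat D * \<alpha> \<in> \<int>"
    and b: "\<And>\<alpha>. b \<alpha> \<noteq> 0 \<Longrightarrow> \<alpha> < \<xi> \<Longrightarrow> of_nat D * \<alpha> \<in> \<int>"
  shows "a \<xi> = 0 \<longleftrightarrow> b \<xi> = 0"
proof (cases "1 < \<xi>")
  \<comment> \<open>All exponents are at least 1, and \<xi> = 1 is excluded because D \<xi> is not
    an integer; so both coefficients vanish.\<close>
  case False
  moreover have "\<xi> \<noteq> 1" using D(2) by auto
  ultimately have "\<not> 1 \<le> \<xi>" by simp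
  then show ?thesis
    using \<gamma> \<gamma>' unfolding newton_puiseux_root_def puiseux_series_def by metis
next
  case True
  define x where "x = real_of_rat \<xi>"
  have x: "1 < x" using True by (simp add: x_def)
  have Dx: "real D * x \<notin> \<int>"
  proof
    assume "real D * x \<in> \<int>"
    then obtain k where "real_of_rat (of_nat D * \<xi>) = real_of_rat (of_int k)"
      by (auto simp: x_def of_rat_mult elim: Ints_cases)
    then have "of_nat D * \<xi> = of_int k" by (simp only: of_rat_eq_iff)
    then show False using D(2) by simp
  qed
  have ser: "puiseux_series a" "puiseux_series b"
    using \<gamma> \<gamma>' unfolding newton_puiseux_root_def by blast+
  let ?l = "puiseux_value a" and ?l' = "puiseux_value b"
  obtain R where R: "((\<lambda>y. (?l y - y * poly R (y powr (1 / real D))) / y powr x) \<longlongrightarrow> a \<xi>) (at_right 0)"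
    unfolding x_def using puiseux_truncation[OF ser(1) D(1) a] by blast
  obtain R' where R': "((\<lambda>y. (?l' y - y * poly R' (y powr (1 / real D))) / y powr x) \<longlongrightarrow> b \<xi>) (at_right 0)"
    unfolding x_def using puiseux_truncation[OF ser(2) D(1) b] by blast
  obtain L where L: "strict_derivative_at_0 \<sigma> L UNIV" "inj L" "isCont \<sigma> 0"
    using C1_diffeo_germ_strict_derivative[OF \<sigma>] .
  from \<sigma> have U: "0 \<in> U" "open U" "\<sigma> 0 = 0"
    unfolding C1_diffeo_germ_def C1_diffeomorphism_def by blast+
  have pos: "\<forall>\<^sub>F y in at_right (0::real). 0 < y" by (rule eventually_at_right_less)
  have id0: "((\<lambda>y::real. y) \<longlongrightarrow> 0) (at_right 0)" by (auto intro: tendsto_eq_intros)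
  have l0: "(?l \<longlongrightarrow> 0) (at_right 0)"
    by (rule tendsto_0_of_quotient[OF fractional_expansion_slope[OF D(1) x R]])
  define P where "P z y = (?l y + z * y powr x, y)" for z y
  have P0: "(P z \<longlongrightarrow> 0) (at_right 0)" for z
  proof -
    have "((\<lambda>y::real. y powr x) \<longlongrightarrow> 0) (at_right 0)"
      using x by (intro tendsto_powr_at_right_0 filterlim_ident) simp
    from tendsto_Pair[OF tendsto_add[OF l0 tendsto_mult_right_zero[OF this]] id0]
    show ?thesis by (simp add: P_def[abs_def] zero_prod_def)
  qed
  have \<sigma>P0: "((\<lambda>y. \<sigma> (P z y)) \<longlongrightarrow> 0) (at_right 0)" for z
    using isCont_tendsto_compose[OF L(3) P0] U(3) by simp
  have in\<gamma>: "\<forall>\<^sub>F y in at_right 0. P 0 y \<in> \<gamma>"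
    using newton_puiseux_root_eventually(1)[OF \<gamma> P0[of 0]] pos
    by eventually_elim (simp add: P_def)
  have f0: "\<forall>\<^sub>F y in at_right 0. f (P 0 y) = 0"
    using newton_puiseux_root_eventually(2)[OF \<gamma> P0[of 0]] in\<gamma> by eventually_elim simp
  have "\<forall>\<^sub>F y in at_right 0. P 0 y \<in> U" using P0 U by (auto dest: topological_tendstoD)
  moreover have "\<forall>\<^sub>F y in at_right 0. \<sigma> (P 0 y) \<in> \<sigma> ` (\<gamma> \<inter> U) \<longleftrightarrow> \<sigma> (P 0 y) \<in> \<gamma>'"
    using img \<sigma>P0[of 0] eventually_compose_filterlim unfolding set_germ_eq_def by blast
  ultimately have im: "\<forall>\<^sub>F y in at_right 0. \<exists>v\<ge>0. \<sigma> (?l y, y) = (?l' v, v)"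
    using in\<gamma> newton_puiseux_root_eventually(1)[OF \<gamma>' \<sigma>P0[of 0]]
  proof eventually_elim
    case (elim y)
    then have "0 \<le> snd (\<sigma> (P 0 y))" "\<sigma> (P 0 y) = (?l' (snd (\<sigma> (P 0 y))), snd (\<sigma> (P 0 y)))"
      by (auto simp: prod_eq_iff)
    then show ?case by (auto simp: P_def)
  qed
  note arcs = image_of_neighbouring_arcs[OF L(1) U(3) L(3,2) D(1) x R R' puiseux_value_0 im, folded P_def]
  obtain c p where c: "0 < c" and p: "p \<noteq> 0"
    and S1: "\<And>z. ((\<lambda>y. snd (\<sigma> (P z y)) / y) \<longlongrightarrow> c) (at_right 0)"
    and S2: "\<And>z. filterlim (\<lambda>y. snd (\<sigma> (P z y))) (at_right 0) (at_right 0)"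
    and S3: "\<And>z. ((\<lambda>y. (fst (\<sigma> (P z y)) - snd (\<sigma> (P z y)) * poly R' (snd (\<sigma> (P z y)) powr (1 / real D)))
        / snd (\<sigma> (P z y)) powr x) \<longlongrightarrow> b \<xi> + p * z) (at_right 0)"
    by (rule arcs, rule that)
  obtain m Q where Q: "Q \<noteq> 0" "\<And>i. coeff Q (Suc i) \<noteq> 0 \<Longrightarrow> coeff Q i = 0"
    and fQ: "\<And>(F :: real filter) u w w0. filterlim u (at_right 0) F \<Longrightarrow> (w \<longlongrightarrow> w0) F \<Longrightarrow>
       ((\<lambda>t. f (u t * poly R (u t powr (1 / real D)) + w t * u t powr x, u t) / u t powr m)
          \<longlongrightarrow> poly Q w0) F"
    by (rule analytic_germ_leading_form[OF f D(1) x Dx, where R = R], rule that)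
  obtain m' Q' where Q': "Q' \<noteq> 0" "\<And>i. coeff Q' (Suc i) \<noteq> 0 \<Longrightarrow> coeff Q' i = 0"
    and gQ: "\<And>(F :: real filter) u w w0. filterlim u (at_right 0) F \<Longrightarrow> (w \<longlongrightarrow> w0) F \<Longrightarrow>
       ((\<lambda>t. g (u t * poly R' (u t powr (1 / real D)) + w t * u t powr x, u t) / u t powr m')
          \<longlongrightarrow> poly Q' w0) F"
    by (rule analytic_germ_leading_form[OF g D(1) x Dx, where R = R'], rule that)
  \<comment> \<open>The arc is the truncation plus \<open>w * y powr x\<close> with \<open>w\<close>
    tending to \<open>a \<xi> + z\<close>.\<close>
  have limf: "((\<lambda>y. f (P z y) / y powr m) \<longlongrightarrow> poly Q (a \<xi> + z)) (at_right 0)" for z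
  proof -
    have "((\<lambda>y. (?l y - y * poly R (y powr (1 / real D))) / y powr x + z) \<longlongrightarrow> a \<xi> + z) (at_right 0)"
      by (intro tendsto_add R tendsto_const)
    from fQ[OF filterlim_ident this] show ?thesis
    proof (rule Lim_transform_eventually)
      show "\<forall>\<^sub>F y in at_right 0. f (y * poly R (y powr (1 / real D))
          + ((?l y - y * poly R (y powr (1 / real D))) / y powr x + z) * y powr x, y) / y powr m
        = f (P z y) / y powr m"
        using pos by eventually_elim (simp add: P_def distrib_right)
    qed
  qed
  \<comment> \<open>Here \<open>u\<close> is the second coordinate of the image arc; passing from
    \<open>u powr m'\<close> to \<open>y powr m'\<close> produces the constant
    \<open>c powr m'\<close>.\<close>
  have limg: "((\<lambda>y. f (P z y) / y powr m') \<longlongrightarrow> c powr m' * poly Q' (b \<xi> + p * z)) (at_right 0)" for z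
  proof -
    let ?u = "\<lambda>y. snd (\<sigma> (P z y))"
    have upos: "\<forall>\<^sub>F y in at_right 0. 0 < ?u y"
      using S2[of z] by (auto simp: filterlim_at elim: eventually_mono)
    have "\<forall>\<^sub>F y in at_right 0. f (P z y) = g (\<sigma> (P z y))"
      using fg P0 eventually_compose_filterlim by blast
    then have "\<forall>\<^sub>F y in at_right 0. (?u y / y) powr m' *
        (g (?u y * poly R' (?u y powr (1 / real D))
          + ((fst (\<sigma> (P z y)) - ?u y * poly R' (?u y powr (1 / real D))) / ?u y powr x) * ?u y powr x, ?u y)
          / ?u y powr m')
        = f (P z y) / y powr m'"
      using pos upos by eventually_elim (simp add: powr_divide)
    moreover have "((\<lambda>y. (?u y / y) powr m') \<longlongrightarrow> c powr m') (at_right 0)"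
      using c by (intro tendsto_powr S1 tendsto_const) simp
    from tendsto_mult[OF this gQ[OF S2 S3]]
    have "((\<lambda>y. (?u y / y) powr m' *
        (g (?u y * poly R' (?u y powr (1 / real D))
          + ((fst (\<sigma> (P z y)) - ?u y * poly R' (?u y powr (1 / real D))) / ?u y powr x) * ?u y powr x, ?u y)
          / ?u y powr m')) \<longlongrightarrow> c powr m' * poly Q' (b \<xi> + p * z)) (at_right 0)" .
    ultimately show ?thesis by (rule Lim_transform_eventually[rotated])
  qed
  \<comment> \<open>Some \<open>z\<close> avoids the roots of both polynomials; along that arc both
    limits are nonzero, which forces m = m'.\<close>
  have "pcompose Q [:a \<xi>, 1:] * pcompose Q' [:b \<xi>, p:] \<noteq> 0"
    using Q(1) Q'(1) p by (simp add: pcompose_eq_0_iff)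
  then obtain z where "poly (pcompose Q [:a \<xi>, 1:] * pcompose Q' [:b \<xi>, p:]) z \<noteq> 0"
    using poly_all_0_iff_0 by blast
  then have "poly Q (a \<xi> + z) \<noteq> 0" "poly Q' (b \<xi> + p * z) \<noteq> 0"
    by (auto simp: poly_pcompose mult.commute)
  then have mm: "m = m'" using order_unique_at_right_0[OF limf _ limg] c by simp
  have eq: "poly Q (a \<xi> + z) = c powr m * poly Q' (b \<xi> + p * z)" for z
    using tendsto_unique[OF _ limf limg[folded mm]] by simp
  \<comment> \<open>The arc z = 0 is the root itself, where \<open>f\<close> vanishes, so
    \<open>a \<xi>\<close> is a root of \<open>Q\<close>.\<close>
  have "((\<lambda>y. f (P 0 y) / y powr m) \<longlongrightarrow> 0) (at_right 0)"
    using f0 by (intro tendsto_eventually) (auto elim: eventually_mono)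
  then have Qa: "poly Q (a \<xi>) = 0" using tendsto_unique[OF _ limf[of 0]] by simp
  have "p * a \<xi> = b \<xi>"
    by (rule affine_conjugate_no_gap[of Q Q', OF Q(2) Q'(2) Q(1) Qa p _ eq]) (use c in auto)
  then show ?thesis using p by auto
qed

section \<open>From vanishing of coefficients to equality of characteristic pairs\<close>

text \<open>With equal prefixes, both series have the same denominator \<open>D\<close> before their
  next characteristic exponents. At the smaller of these, \<open>ab\<close> applies, so both
  coefficients are nonzero there; but the series with the later exponent, or with none left, has
  only exponents in (1/D)Z up to that point.\<close>

lemma is_puiseux_pairs_step_transfer:
  assumes ps: "is_puiseux_pairs a ps" and qs: "is_puiseux_pairs b qs"
    and tk: "take i ps = take i qs" and i: "i < length ps" "i \<le> length qs"
    and ab: "\<And>D \<xi>. 0 < D \<Longrightarrow> of_nat D * \<xi> \<notin> \<int> \<Longrightarrow>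
      (\<And>\<alpha>. a \<alpha> \<noteq> 0 \<Longrightarrow> \<alpha> < \<xi> \<Longrightarrow> of_nat D * \<alpha> \<in> \<int>) \<Longrightarrow>
      (\<And>\<alpha>. b \<alpha> \<noteq> 0 \<Longrightarrow> \<alpha> < \<xi> \<Longrightarrow> of_nat D * \<alpha> \<in> \<int>) \<Longrightarrow> a \<xi> = 0 \<longleftrightarrow> b \<xi> = 0"
  shows "i < length qs \<and> ps ! i = qs ! i"
proof -
  note gp = is_puiseux_pairs_good[OF ps] and gq = is_puiseux_pairs_good[OF qs]
  note denp = is_puiseux_pairs_denom[OF ps i(1)]
  have D: "pair_denom qs i = pair_denom ps i" by (rule pair_denom_cong[OF tk, symmetric])
  let ?D = "pair_denom ps i"
  have D0: "0 < ?D" using pair_denom_pos[OF gp] i by simp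
  note pi = pairs_nth[OF gp i(1)]
  have nip: "of_nat ?D * pair_exponent ps i \<notin> \<int>"
    unfolding denom_mult_exponent[OF gp i(1)] using pi by (intro coprime_frac_not_Int)
  have ap: "a (pair_exponent ps i) \<noteq> 0" by (rule is_puiseux_pairs_nonzero[OF ps i(1)])
  have iq: "i < length qs"
  proof (rule ccontr)
    assume "\<not> i < length qs"
    then have "i = length qs" using i by simp
    \<comment> \<open>With no pair left in \<open>qs\<close>, every exponent of \<open>b\<close>
      lies in (1/D)Z.\<close>
    then have all: "of_nat ?D * \<alpha> \<in> \<int>" if "b \<alpha> \<noteq> 0" for \<alpha>
      using is_puiseux_pairs_all_denom[OF qs that] D by simp
    have "b (pair_exponent ps i) \<noteq> 0" using ab[OF D0 nip denp all] ap by blast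
    then show False using all nip by blast
  qed
  note denq = is_puiseux_pairs_denom[OF qs iq, unfolded D]
  note qi = pairs_nth[OF gq iq]
  have niq: "of_nat ?D * pair_exponent qs i \<notin> \<int>"
    unfolding denom_mult_exponent[OF gq iq, unfolded D] using qi by (intro coprime_frac_not_Int)
  have bq: "b (pair_exponent qs i) \<noteq> 0" by (rule is_puiseux_pairs_nonzero[OF qs iq])
  have "\<not> pair_exponent ps i < pair_exponent qs i"
  proof
    assume less: "pair_exponent ps i < pair_exponent qs i"
    then have "b (pair_exponent ps i) \<noteq> 0" using ab[OF D0 nip denp] denq ap by fastforce
    then show False using denq less nip by blast
  qed
  moreover have "\<not> pair_exponent qs i < pair_exponent ps i"
  proof
    assume less: "pair_exponent qs i < pair_exponent ps i"
    then have "a (pair_exponent qs i) \<noteq> 0" using ab[OF D0 niq _ denq] denp bq by fastforce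
    then show False using denp less niq by blast
  qed
  ultimately have "pair_exponent ps i = pair_exponent qs i" by simp
  then have "(of_nat (fst (ps ! i)) / of_nat (snd (ps ! i)) :: rat)
               = of_nat (fst (qs ! i)) / of_nat (snd (qs ! i))"
    using denom_mult_exponent[OF gp i(1)] denom_mult_exponent[OF gq iq] D by simp
  then have "fst (ps ! i) = fst (qs ! i) \<and> snd (ps ! i) = snd (qs ! i)"
    using pi qi by (intro coprime_frac_eq) auto
  then show ?thesis using iq by (simp add: prod_eq_iff)
qed

lemma is_puiseux_pairs_eq_transfer:
  assumes ps: "is_puiseux_pairs a ps" and qs: "is_puiseux_pairs b qs"
    and ab: "\<And>D \<xi>. 0 < D \<Longrightarrow> of_nat D * \<xi> \<notin> \<int> \<Longrightarrow>
      (\<And>\<alpha>. a \<alpha> \<noteq> 0 \<Longrightarrow> \<alpha> < \<xi> \<Longrightarrow> of_nat D * \<alpha> \<in> \<int>) \<Longrightarrow>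
      (\<And>\<alpha>. b \<alpha> \<noteq> 0 \<Longrightarrow> \<alpha> < \<xi> \<Longrightarrow> of_nat D * \<alpha> \<in> \<int>) \<Longrightarrow> a \<xi> = 0 \<longleftrightarrow> b \<xi> = 0"
  shows "ps = qs"
proof -
  have 1: "i \<le> length ps \<Longrightarrow> i \<le> length qs \<and> take i ps = take i qs" for i
  proof (induction i)
    case (Suc i)
    then show ?case
      using is_puiseux_pairs_step_transfer[OF ps qs, of i] ab by (simp add: take_Suc_conv_app_nth)
  qed simp
  have "\<not> length ps < length qs"
  proof
    assume "length ps < length qs"
    moreover have "take (length ps) qs = take (length ps) ps" using 1[of "length ps"] by simp
    \<comment> \<open>The transfer hypothesis is symmetric, so the step also applies with the roles
      exchanged and rules out a longer \<open>qs\<close>.\<close>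
    moreover have "b \<xi> = 0 \<longleftrightarrow> a \<xi> = 0" if "0 < D" "of_nat D * \<xi> \<notin> \<int>"
      "\<And>\<alpha>. b \<alpha> \<noteq> 0 \<Longrightarrow> \<alpha> < \<xi> \<Longrightarrow> of_nat D * \<alpha> \<in> \<int>"
      "\<And>\<alpha>. a \<alpha> \<noteq> 0 \<Longrightarrow> \<alpha> < \<xi> \<Longrightarrow> of_nat D * \<alpha> \<in> \<int>" for D \<xi>
      using ab[OF that(1,2,4,3)] by blast
    ultimately show False
      using is_puiseux_pairs_step_transfer[OF qs ps, of "length ps"] by simp
  qed
  then show ?thesis using 1[of "length ps"] by simp
qed

theorem proposition0p3:
  fixes f g :: "real \<times> real \<Rightarrow> real"
    and \<sigma> :: "real \<times> real \<Rightarrow> real \<times> real"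
    and U V \<gamma> \<gamma>' :: "(real \<times> real) set"
    and a b :: "rat \<Rightarrow> real"
  assumes "C1_diffeo_germ U V \<sigma>"
    and "analytic_germ f" and "f 0 = 0" and "\<not> (\<forall>\<^sub>F p in nhds 0. f p = 0)"
    and "analytic_germ g" and "g 0 = 0" and "\<not> (\<forall>\<^sub>F p in nhds 0. g p = 0)"
    and "\<forall>\<^sub>F p in nhds 0. f p = g (\<sigma> p)"
    and "newton_puiseux_root f a \<gamma>"
    and "newton_puiseux_root g b \<gamma>'"
    and "set_germ_eq (\<sigma> ` (\<gamma> \<inter> U)) \<gamma>'"
  shows "puiseux_pairs a = puiseux_pairs b"
proof (rule is_puiseux_pairs_eq_transfer)
  show "is_puiseux_pairs a (puiseux_pairs a)" "is_puiseux_pairs b (puiseux_pairs b)"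
    using assms(9,10) is_puiseux_pairs_puiseux_pairs unfolding newton_puiseux_root_def by blast+
  show "a \<xi> = 0 \<longleftrightarrow> b \<xi> = 0"
    if "0 < D" "of_nat D * \<xi> \<notin> \<int>"
      "\<And>\<alpha>. a \<alpha> \<noteq> 0 \<Longrightarrow> \<alpha> < \<xi> \<Longrightarrow> of_nat D * \<alpha> \<in> \<int>"
      "\<And>\<alpha>. b \<alpha> \<noteq> 0 \<Longrightarrow> \<alpha> < \<xi> \<Longrightarrow> of_nat D * \<alpha> \<in> \<int>" for D \<xi>
    using puiseux_coeff_eq_0_iff[OF assms(1,2,4,5,7-11) that] .
qed

end
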